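(* The Gersten group $$G=\langle a,b,c,t\mid tat^{-1}=a,\ tbt^{-1}=ba,\ tct^{-1}=ca^2\rangle$$ is a cyclic-subgroup-separable tubular group that does not have property (VRC).
   Context: A tubular group is a group that splits as a finite graph of groups with all vertex groups isomorphic to $\mathbb{Z}^2$ and all edge groups isomorphic to $\mathbb{Z}$. A subgroup $K$ of a group $G$ is separable if it is an intersection of finite-index subgroups of $G$; $G$ is cyclic-subgroup-separable if every cyclic subgroup of $G$ is separable. A group $G$ has property (VRC) if for every cyclic subgroup $C\le G$ there is a finite-index subgroup $H\le G$ with $C\le H$ and an epimorphism $H\to C$ whose restriction to $C$ is the identity. *)

theory Defs
  imports "HOL-Algebra.Elementary_Groups" "Graph_Theory.Digraph_Component"
begin

section \<open>Groups given by generators and relations\<close>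

datatype 'x letter = Gen 'x | Inv 'x

text \<open>The least congruence on the monoid of words over the letters \<open>x\<close>, \<open>x\<inverse>\<close> (\<open>x \<in> X\<close>) that
  identifies \<open>x x\<inverse>\<close> and \<open>x\<inverse> x\<close> with the empty word and \<open>u\<close> with \<open>v\<close> for every relation
  \<open>u = v\<close>, i.e. for every \<open>(u, v) \<in> R\<close>.\<close>

definition group_words :: "'x set \<Rightarrow> 'x letter list set" where
  "group_words X = lists (Gen ` X \<union> Inv ` X)"

inductive pres_cong :: "'x set \<Rightarrow> ('x letter list \<times> 'x letter list) set
    \<Rightarrow> 'x letter list \<Rightarrow> 'x letter list \<Rightarrow> bool"
  for X R where
  refl: "w \<in> group_words X \<Longrightarrow> pres_cong X R w w"
| sym: "pres_cong X R u v \<Longrightarrow> pres_cong X R v u"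
| trans: "pres_cong X R u v \<Longrightarrow> pres_cong X R v w \<Longrightarrow> pres_cong X R u w"
| append: "pres_cong X R u u' \<Longrightarrow> pres_cong X R v v' \<Longrightarrow> pres_cong X R (u @ v) (u' @ v')"
| Gen_Inv: "x \<in> X \<Longrightarrow> pres_cong X R [Gen x, Inv x] []"
| Inv_Gen: "x \<in> X \<Longrightarrow> pres_cong X R [Inv x, Gen x] []"
| rel: "(u, v) \<in> R \<Longrightarrow> u \<in> group_words X \<Longrightarrow> v \<in> group_words X \<Longrightarrow> pres_cong X R u v"

definition pres_class :: "'x set \<Rightarrow> ('x letter list \<times> 'x letter list) set
    \<Rightarrow> 'x letter list \<Rightarrow> 'x letter list set" where
  "pres_class X R w = {v. pres_cong X R w v}"

definition presented_group :: "'x set \<Rightarrow> ('x letter list \<times> 'x letter list) set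
    \<Rightarrow> 'x letter list set monoid" where
  "presented_group X R =
     \<lparr>carrier = pres_class X R ` group_words X,
      monoid.mult = (\<lambda>A B. \<Union>u\<in>A. \<Union>v\<in>B. pres_class X R (u @ v)),
      one = pres_class X R []\<rparr>"

lemma pres_cong_words:
  "pres_cong X R u v \<Longrightarrow> u \<in> group_words X \<and> v \<in> group_words X"
  by (induction rule: pres_cong.induct) (auto simp: group_words_def)

lemma pres_class_eq: "pres_cong X R u v \<Longrightarrow> pres_class X R u = pres_class X R v"
  unfolding pres_class_def using pres_cong.sym pres_cong.trans by blast

lemma pres_class_eq_iff:
  assumes "u \<in> group_words X" "v \<in> group_words X"
  shows "pres_class X R u = pres_class X R v \<longleftrightarrow> pres_cong X R u v"
proof
  assume "pres_class X R u = pres_class X R v"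
  then have "v \<in> pres_class X R u"
    using assms by (simp add: pres_class_def pres_cong.refl)
  then show "pres_cong X R u v" by (simp add: pres_class_def)
qed (rule pres_class_eq)

lemma presented_group_mult:
  assumes "u \<in> group_words X" "v \<in> group_words X"
  shows "pres_class X R u \<otimes>\<^bsub>presented_group X R\<^esub> pres_class X R v = pres_class X R (u @ v)"
proof -
  have eq: "pres_class X R (u' @ v') = pres_class X R (u @ v)"
    if "u' \<in> pres_class X R u" "v' \<in> pres_class X R v" for u' v'
  proof (rule pres_class_eq[symmetric], rule pres_cong.append)
    show "pres_cong X R u u'" "pres_cong X R v v'"
      using that by (simp_all add: pres_class_def)
  qed
  moreover have "u \<in> pres_class X R u" "v \<in> pres_class X R v"
    using assms by (simp_all add: pres_class_def pres_cong.refl)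
  ultimately show ?thesis
    unfolding presented_group_def monoid.simps by blast
qed

fun inv_letter :: "'x letter \<Rightarrow> 'x letter" where
  "inv_letter (Gen x) = Inv x"
| "inv_letter (Inv x) = Gen x"

lemma presented_group_left_inverse:
  assumes "w \<in> group_words X"
  shows "rev (map inv_letter w) \<in> group_words X \<and> pres_cong X R (rev (map inv_letter w) @ w) []"
  using assms
proof (induction w)
  case Nil
  then show ?case by (simp add: group_words_def pres_cong.refl)
next
  case (Cons l w)
  let ?i = "rev (map inv_letter w)"
  have w: "w \<in> group_words X" and l: "l \<in> Gen ` X \<union> Inv ` X"
    using Cons.prems by (auto simp: group_words_def)
  with Cons.IH have i: "?i \<in> group_words X" "pres_cong X R (?i @ w) []" by auto
  have l': "inv_letter l \<in> Gen ` X \<union> Inv ` X" "pres_cong X R [inv_letter l, l] []"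
    using l by (auto simp: pres_cong.Gen_Inv pres_cong.Inv_Gen)
  have "pres_cong X R (?i @ [inv_letter l, l] @ w) (?i @ [] @ w)"
    by (intro pres_cong.append pres_cong.refl l' w i)
  then show ?case
    using i l'(1) pres_cong.trans[of X R "?i @ [inv_letter l, l] @ w" "?i @ w" "[]"]
    by (simp add: group_words_def)
qed

lemma group_presented_group: "group (presented_group X R)"
proof (rule groupI)
  fix a b c
  assume "a \<in> carrier (presented_group X R)" "b \<in> carrier (presented_group X R)"
    and "c \<in> carrier (presented_group X R)"
  then obtain u v w where
      "a = pres_class X R u" "b = pres_class X R v" "c = pres_class X R w"
      "u \<in> group_words X" "v \<in> group_words X" "w \<in> group_words X"
    by (auto simp: presented_group_def)
  moreover from this have "u @ v \<in> group_words X" "v @ w \<in> group_words X"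
    by (auto simp: group_words_def)
  ultimately show "a \<otimes>\<^bsub>presented_group X R\<^esub> b \<otimes>\<^bsub>presented_group X R\<^esub> c
      = a \<otimes>\<^bsub>presented_group X R\<^esub> (b \<otimes>\<^bsub>presented_group X R\<^esub> c)"
    by (simp add: presented_group_mult)
next
  fix a b
  assume "a \<in> carrier (presented_group X R)" "b \<in> carrier (presented_group X R)"
  then obtain u v where
      "a = pres_class X R u" "b = pres_class X R v" "u \<in> group_words X" "v \<in> group_words X"
    by (auto simp: presented_group_def)
  moreover from this have "u @ v \<in> group_words X"
    by (auto simp: group_words_def)
  ultimately show "a \<otimes>\<^bsub>presented_group X R\<^esub> b \<in> carrier (presented_group X R)"
    by (simp add: presented_group_mult) (simp add: presented_group_def)
next
  have nil: "[] \<in> group_words X" by (simp add: group_words_def)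
  then show "\<one>\<^bsub>presented_group X R\<^esub> \<in> carrier (presented_group X R)"
    by (simp add: presented_group_def)
  fix a assume "a \<in> carrier (presented_group X R)"
  then obtain w where w: "a = pres_class X R w" "w \<in> group_words X"
    by (auto simp: presented_group_def)
  have one: "\<one>\<^bsub>presented_group X R\<^esub> = pres_class X R []"
    by (simp add: presented_group_def)
  show "\<one>\<^bsub>presented_group X R\<^esub> \<otimes>\<^bsub>presented_group X R\<^esub> a = a"
    using presented_group_mult[OF nil w(2), of R] by (simp add: one w(1))
  let ?i = "rev (map inv_letter w)"
  have i: "?i \<in> group_words X" "pres_cong X R (?i @ w) []"
    using presented_group_left_inverse[OF w(2)] by auto
  have "pres_class X R ?i \<otimes>\<^bsub>presented_group X R\<^esub> a = \<one>\<^bsub>presented_group X R\<^esub>"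
    by (simp only: one w(1) presented_group_mult[OF i(1) w(2)] pres_class_eq[OF i(2)])
  moreover have "pres_class X R ?i \<in> carrier (presented_group X R)"
    using i by (simp add: presented_group_def)
  ultimately show "\<exists>b\<in>carrier (presented_group X R). b \<otimes>\<^bsub>presented_group X R\<^esub> a = \<one>\<^bsub>presented_group X R\<^esub>"
    by blast
qed


section \<open>Separability and virtual retractions\<close>

definition finite_index_subgroup :: "'a set \<Rightarrow> ('a, 'm) monoid_scheme \<Rightarrow> bool" where
  "finite_index_subgroup H G \<longleftrightarrow> subgroup H G \<and> finite (rcosets\<^bsub>G\<^esub> H)"

definition separable_subgroup :: "'a set \<Rightarrow> ('a, 'm) monoid_scheme \<Rightarrow> bool" where
  "separable_subgroup K G \<longleftrightarrow> subgroup K G \<and>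
     (\<exists>\<H>. \<H> \<noteq> {} \<and> (\<forall>H\<in>\<H>. finite_index_subgroup H G) \<and> K = \<Inter>\<H>)"

definition cyclic_subgroup_separable :: "('a, 'm) monoid_scheme \<Rightarrow> bool" where
  "cyclic_subgroup_separable G \<longleftrightarrow>
     (\<forall>g\<in>carrier G. separable_subgroup (generate G {g}) G)"

definition has_VRC :: "('a, 'm) monoid_scheme \<Rightarrow> bool" where
  "has_VRC G \<longleftrightarrow>
     (\<forall>g\<in>carrier G. let C = generate G {g} in
        \<exists>H. finite_index_subgroup H G \<and> C \<subseteq> H \<and>
          (\<exists>r\<in>epi (G\<lparr>carrier := H\<rparr>) (G\<lparr>carrier := C\<rparr>). \<forall>x\<in>C. r x = x))"


section \<open>Graphs of groups and tubular groups\<close>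

text \<open>Each unoriented edge is represented by a single arc, with an arbitrarily chosen orientation;
  \<open>tail_map\<close> and \<open>head_map\<close> embed its edge group into the vertex groups at its two ends.
  Loops and multiple edges are allowed.\<close>

record ('v, 'e, 'g, 'h) graph_of_groups =
  underlying :: "('v, 'e) pre_digraph"
  vertex_group :: "'v \<Rightarrow> 'g monoid"
  edge_group :: "'e \<Rightarrow> 'h monoid"
  tail_map :: "'e \<Rightarrow> 'h \<Rightarrow> 'g"
  head_map :: "'e \<Rightarrow> 'h \<Rightarrow> 'g"

text \<open>The library's \<open>connected\<close> ignores the orientation of the arcs and entails that there is a vertex.\<close>

definition finite_graph_of_groups :: "('v, 'e, 'g, 'h) graph_of_groups \<Rightarrow> bool" where
  "finite_graph_of_groups \<G> \<longleftrightarrow>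
     (let \<Gamma> = underlying \<G> in
       fin_digraph \<Gamma> \<and> connected \<Gamma> \<and>
       (\<forall>v\<in>verts \<Gamma>. group (vertex_group \<G> v)) \<and>
       (\<forall>e\<in>arcs \<Gamma>. group (edge_group \<G> e) \<and>
          tail_map \<G> e \<in> mon (edge_group \<G> e) (vertex_group \<G> (tail \<Gamma> e)) \<and>
          head_map \<G> e \<in> mon (edge_group \<G> e) (vertex_group \<G> (head \<Gamma> e))))"

text \<open>Serre's description of the fundamental group. The path group is generated by the disjoint
  union of the vertex groups and by the edges, subject to the relations of the vertex groups and
  \<open>e \<cdot> head_map e x \<cdot> e\<inverse> = tail_map e x\<close> for \<open>x\<close> in the edge group of \<open>e\<close>. The fundamental group at
  \<open>v\<close> is its subgroup of all elements represented by words that traverse a closed path at \<open>v\<close>,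
  with elements of the vertex groups inserted at the vertices being passed.\<close>

datatype ('v, 'e, 'g) path_gen = At 'v 'g | Along 'e

definition path_gens :: "('v, 'e, 'g, 'h) graph_of_groups \<Rightarrow> ('v, 'e, 'g) path_gen set" where
  "path_gens \<G> =
     {At v g | v g. v \<in> verts (underlying \<G>) \<and> g \<in> carrier (vertex_group \<G> v)} \<union>
     Along ` arcs (underlying \<G>)"

definition path_rels :: "('v, 'e, 'g, 'h) graph_of_groups \<Rightarrow>
    (('v, 'e, 'g) path_gen letter list \<times> ('v, 'e, 'g) path_gen letter list) set" where
  "path_rels \<G> =
     {([Gen (At v g), Gen (At v h)], [Gen (At v (g \<otimes>\<^bsub>vertex_group \<G> v\<^esub> h))]) | v g h.
        v \<in> verts (underlying \<G>) \<and>
        g \<in> carrier (vertex_group \<G> v) \<and> h \<in> carrier (vertex_group \<G> v)} \<union>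
     {([Gen (Along e), Gen (At (head (underlying \<G>) e) (head_map \<G> e x)), Inv (Along e)],
       [Gen (At (tail (underlying \<G>) e) (tail_map \<G> e x))]) | e x.
        e \<in> arcs (underlying \<G>) \<and> x \<in> carrier (edge_group \<G> e)}"

inductive path_word :: "('v, 'e, 'g, 'h) graph_of_groups \<Rightarrow>
    'v \<Rightarrow> ('v, 'e, 'g) path_gen letter list \<Rightarrow> 'v \<Rightarrow> bool"
  for \<G> where
  Nil: "v \<in> verts (underlying \<G>) \<Longrightarrow> path_word \<G> v [] v"
| At: "v \<in> verts (underlying \<G>) \<Longrightarrow> g \<in> carrier (vertex_group \<G> v) \<Longrightarrow> path_word \<G> v w v'
    \<Longrightarrow> path_word \<G> v (Gen (At v g) # w) v'"
| Forward: "e \<in> arcs (underlying \<G>) \<Longrightarrow> path_word \<G> (head (underlying \<G>) e) w v'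
    \<Longrightarrow> path_word \<G> (tail (underlying \<G>) e) (Gen (Along e) # w) v'"
| Backward: "e \<in> arcs (underlying \<G>) \<Longrightarrow> path_word \<G> (tail (underlying \<G>) e) w v'
    \<Longrightarrow> path_word \<G> (head (underlying \<G>) e) (Inv (Along e) # w) v'"

definition fundamental_group :: "('v, 'e, 'g, 'h) graph_of_groups \<Rightarrow> 'v \<Rightarrow>
    ('v, 'e, 'g) path_gen letter list set monoid" where
  "fundamental_group \<G> v =
     (presented_group (path_gens \<G>) (path_rels \<G>))
       \<lparr>carrier := pres_class (path_gens \<G>) (path_rels \<G>) ` {w. path_word \<G> v w v}\<rparr>"

text \<open>Fixing the types of vertices, edges and group elements is no restriction: every finite graph
  of groups with vertex groups \<open>\<int>\<^sup>2\<close> and edge groups \<open>\<int>\<close> is isomorphic to one over these types.\<close>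

definition tubular_group :: "('a, 'm) monoid_scheme \<Rightarrow> bool" where
  "tubular_group G \<longleftrightarrow> group G \<and>
     (\<exists>(\<G> :: (nat, nat, int \<times> int, int) graph_of_groups) v.
        finite_graph_of_groups \<G> \<and> v \<in> verts (underlying \<G>) \<and>
        (\<forall>u\<in>verts (underlying \<G>). vertex_group \<G> u \<cong> integer_group \<times>\<times> integer_group) \<and>
        (\<forall>e\<in>arcs (underlying \<G>). edge_group \<G> e \<cong> integer_group) \<and>
        G \<cong> fundamental_group \<G> v)"


section \<open>The Gersten group\<close>

datatype gersten_gen = gen_a | gen_b | gen_c | gen_t

definition gersten_group :: "gersten_gen letter list set monoid" where
  "gersten_group = presented_group {gen_a, gen_b, gen_c, gen_t}
     {([Gen gen_t, Gen gen_a, Inv gen_t], [Gen gen_a]),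
      ([Gen gen_t, Gen gen_b, Inv gen_t], [Gen gen_b, Gen gen_a]),
      ([Gen gen_t, Gen gen_c, Inv gen_t], [Gen gen_c, Gen gen_a, Gen gen_a])}"

end

theory Submission
  imports Defs "HOL-Algebra.Bij" "HOL-Algebra.Generated_Groups" "HOL-Algebra.Zassenhaus"
    "HOL-Library.Function_Algebras"
begin

text \<open>Let \<open>G\<close> be the Gersten group. It is the semidirect product of the free group \<open>F\<close> on \<open>a, b, c\<close> and
  \<open>\<langle>t\<rangle>\<close>, where \<open>t\<close> acts by \<open>a \<mapsto> a\<close>, \<open>b \<mapsto> b a\<close>, \<open>c \<mapsto> c a\<^sup>2\<close>.

  \<^bold>\<open>Tubular.\<close> The relations can be read as \<open>b (a t) b\<inverse> = t\<close> and \<open>c (a\<^sup>2 t) c\<inverse> = t\<close>, which presents \<open>G\<close>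
  as a multiple HNN extension of \<open>\<langle>a, t\<rangle> \<cong> \<int>\<^sup>2\<close> with stable letters \<open>b\<close> and \<open>c\<close>: a graph of groups with
  one vertex and two loops.

  \<^bold>\<open>No property (VRC).\<close> By the same relations \<open>t\<close>, \<open>a t\<close>, \<open>a\<^sup>2 t\<close> are conjugate. Given a homomorphism
  \<open>f\<close> from a subgroup of finite index to \<open>\<int>\<close>, the sum of squares of the conjugates of \<open>f\<close> is invariant
  under conjugation in \<open>G\<close> and restricts to a positive semidefinite quadratic form on \<open>\<langle>a, t\<rangle>\<close>. It takes
  the same value at the three equidistant points above, so by convexity it vanishes at \<open>a\<close>, and then
  so does \<open>f\<close> (\<open>virtual_hom_vanishes\<close>). But a retraction onto the infinite cyclic group \<open>\<langle>a\<rangle>\<close> does not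
  vanish at \<open>a\<close>.

  \<^bold>\<open>Cyclic subgroup separable.\<close> It suffices to find, for each \<open>g \<noteq> \<one>\<close>, an integer-valued function
  on \<open>G\<close> that detects the exponent \<open>k\<close> of a power \<open>g\<^sup>k\<close> up to a constant factor and that is
  determined modulo every integer by a finite quotient (\<open>cyclic_subgroup_separableI\<close>): an element that
  looks like a power of \<open>g\<close> in every finite quotient then has a consistent integer exponent. If
  \<open>t\<close> has nonzero exponent sum in \<open>g\<close>, this sum is such a function. Otherwise \<open>g\<close> lies in \<open>F\<close>, and the
  Magnus embedding helps: \<open>x \<mapsto> 1 + x\<close> embeds \<open>F\<close> into the units of the power series ring over \<open>\<int>\<close> in noncommuting variables, and if the series of
  \<open>g\<close> is \<open>1\<close> plus a nonzero term \<open>g\<^sub>d\<close> of degree \<open>d\<close> plus higher terms, that of \<open>g\<^sup>k\<close> starts with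
  \<open>1 + k g\<^sub>d\<close> (\<open>leading_coefficient_pow\<close>). To define the coefficients on all of \<open>G\<close>, let \<open>F\<close> act on power
  series by left multiplication and \<open>t\<close> by the substitution that corresponds to its action on \<open>F\<close>, and
  take the coefficients of the image of the series \<open>1\<close>. All operators preserve the degree filtration,
  so the coefficients modulo \<open>m\<close> are determined by the action of \<open>G\<close> on the finite set of series
  modulo \<open>m\<close> and modulo large degrees (\<open>profinitely_continuous_coefficient\<close>).\<close>


section \<open>Homomorphisms out of a presented group\<close>

definition pres_gen :: "'x set \<Rightarrow> ('x letter list \<times> 'x letter list) set \<Rightarrow> 'x \<Rightarrow> 'x letter list set"
  where "pres_gen X R x = pres_class X R [Gen x]"

fun letter_val :: "('b, 'm) monoid_scheme \<Rightarrow> ('x \<Rightarrow> 'b) \<Rightarrow> 'x letter \<Rightarrow> 'b" where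
  "letter_val H f (Gen x) = f x"
| "letter_val H f (Inv x) = inv\<^bsub>H\<^esub> f x"

primrec word_val :: "('b, 'm) monoid_scheme \<Rightarrow> ('x \<Rightarrow> 'b) \<Rightarrow> 'x letter list \<Rightarrow> 'b" where
  "word_val H f [] = \<one>\<^bsub>H\<^esub>"
| "word_val H f (l # w) = letter_val H f l \<otimes>\<^bsub>H\<^esub> word_val H f w"

lemma group_words_simps [simp]:
  "[] \<in> group_words X"
  "Gen x # w \<in> group_words X \<longleftrightarrow> x \<in> X \<and> w \<in> group_words X"
  "Inv x # w \<in> group_words X \<longleftrightarrow> x \<in> X \<and> w \<in> group_words X"
  "u @ w \<in> group_words X \<longleftrightarrow> u \<in> group_words X \<and> w \<in> group_words X"
  by (auto simp: group_words_def)

lemma group_words_Cons: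
  "l # w \<in> group_words X \<longleftrightarrow> (\<exists>x\<in>X. l = Gen x \<or> l = Inv x) \<and> w \<in> group_words X"
  by (auto simp: group_words_def)

lemma (in group) word_val_closed:
  "f \<in> X \<rightarrow> carrier G \<Longrightarrow> w \<in> group_words X \<Longrightarrow> word_val G f w \<in> carrier G"
  by (induction w) (auto simp: group_words_Cons Pi_iff)

lemma (in group) word_val_append:
  assumes "f \<in> X \<rightarrow> carrier G" "u \<in> group_words X" "w \<in> group_words X"
  shows "word_val G f (u @ w) = word_val G f u \<otimes> word_val G f w"
  using assms(2)
proof (induction u)
  case Nil
  then show ?case using assms by (simp add: word_val_closed)
next
  case (Cons l u)
  then have "letter_val G f l \<in> carrier G" "u \<in> group_words X"
    using assms(1) by (auto simp: group_words_Cons Pi_iff)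
  then show ?case using Cons.IH assms by (simp add: word_val_closed m_assoc)
qed

lemma (in group) word_val_pres_cong:
  assumes f: "f \<in> X \<rightarrow> carrier G"
    and rels: "\<And>u v. (u, v) \<in> R \<Longrightarrow> u \<in> group_words X \<Longrightarrow> v \<in> group_words X \<Longrightarrow>
      word_val G f u = word_val G f v"
    and "pres_cong X R u v"
  shows "word_val G f u = word_val G f v"
  using assms(3)
proof (induction rule: pres_cong.induct)
  case (append u u' v v')
  then show ?case
    by (auto dest!: pres_cong_words simp: word_val_append[OF f])
next
  case (Gen_Inv x)
  then have "f x \<in> carrier G" using f by auto
  then show ?case by simp
next
  case (Inv_Gen x)
  then have "f x \<in> carrier G" using f by auto
  then show ?case by simp
qed (auto intro: rels)

text \<open>Von Dyck's theorem. Evaluating words respects the generating rules of the congruence, so it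
  descends to classes; the value on a class is computed at an arbitrarily chosen representative.\<close>

lemma (in group) von_dyck:
  assumes f: "f \<in> X \<rightarrow> carrier G"
    and rels: "\<And>u v. (u, v) \<in> R \<Longrightarrow> u \<in> group_words X \<Longrightarrow> v \<in> group_words X \<Longrightarrow>
      word_val G f u = word_val G f v"
  obtains \<phi> where "\<phi> \<in> hom (presented_group X R) G"
    and "\<And>x. x \<in> X \<Longrightarrow> \<phi> (pres_gen X R x) = f x"
proof -
  define \<phi> where "\<phi> A = word_val G f (SOME w. w \<in> A)" for A
  have \<phi>: "\<phi> (pres_class X R w) = word_val G f w" if "w \<in> group_words X" for w
  proof -
    have "w \<in> pres_class X R w"
      using that by (simp add: pres_class_def pres_cong.refl)
    then have "(SOME v. v \<in> pres_class X R w) \<in> pres_class X R w"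
      by (rule someI)
    then have "pres_cong X R w (SOME v. v \<in> pres_class X R w)"
      by (simp add: pres_class_def)
    then have "word_val G f w = word_val G f (SOME v. v \<in> pres_class X R w)"
      by (rule word_val_pres_cong[OF f, rotated]) (auto intro: rels)
    then show ?thesis by (simp add: \<phi>_def)
  qed
  show thesis
  proof
    show "\<phi> \<in> hom (presented_group X R) G"
    proof (rule homI)
      fix A assume "A \<in> carrier (presented_group X R)"
      then show "\<phi> A \<in> carrier G"
        by (auto simp: presented_group_def \<phi> intro: word_val_closed[OF f])
    next
      fix A B assume "A \<in> carrier (presented_group X R)" "B \<in> carrier (presented_group X R)"
      then obtain u v where "A = pres_class X R u" "B = pres_class X R v"
        "u \<in> group_words X" "v \<in> group_words X"
        by (auto simp: presented_group_def)
      then show "\<phi> (A \<otimes>\<^bsub>presented_group X R\<^esub> B) = \<phi> A \<otimes> \<phi> B"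
        by (simp add: presented_group_mult \<phi> word_val_append[OF f])
    qed
    show "\<phi> (pres_gen X R x) = f x" if "x \<in> X" for x
    proof -
      have "f x \<in> carrier G" using f that by auto
      then show ?thesis using that by (simp add: pres_gen_def \<phi>)
    qed
  qed
qed

lemma pres_gen_closed: "x \<in> X \<Longrightarrow> pres_gen X R x \<in> carrier (presented_group X R)"
  by (auto simp: pres_gen_def presented_group_def)

lemma pres_class_letter:
  assumes "x \<in> X"
  shows "pres_class X R [Inv x] = inv\<^bsub>presented_group X R\<^esub> (pres_gen X R x)"
proof (rule group.inv_equality[OF group_presented_group, symmetric])
  show "pres_class X R [Inv x] \<otimes>\<^bsub>presented_group X R\<^esub> pres_gen X R x = \<one>\<^bsub>presented_group X R\<^esub>"
    using assms pres_class_eq[OF pres_cong.Inv_Gen[OF assms]]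
    by (simp add: pres_gen_def presented_group_mult) (simp add: presented_group_def)
qed (use assms in \<open>auto simp: pres_gen_closed\<close>, auto simp: presented_group_def)

text \<open>This translates equations between words into equations between group elements.\<close>

lemma word_val_pres_gen:
  assumes "w \<in> group_words X"
  shows "word_val (presented_group X R) (pres_gen X R) w = pres_class X R w"
  using assms
proof (induction w)
  case Nil
  then show ?case by (simp add: presented_group_def)
next
  case (Cons l w)
  then have "[l] \<in> group_words X" "w \<in> group_words X"
    and "letter_val (presented_group X R) (pres_gen X R) l = pres_class X R [l]"
    by (auto simp: group_words_Cons pres_class_letter) (simp_all add: pres_gen_def)
  then show ?case using Cons.IH presented_group_mult[of "[l]" X w R] by simp
qed

lemma presented_group_rel:
  assumes "(u, v) \<in> R" "u \<in> group_words X" "v \<in> group_words X"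
  shows "word_val (presented_group X R) (pres_gen X R) u
    = word_val (presented_group X R) (pres_gen X R) v"
  using assms by (simp add: word_val_pres_gen pres_class_eq pres_cong.rel)

text \<open>Writing a word as its first letter times the rest turns induction on words into induction on
  group elements.\<close>

lemma presented_group_induct [consumes 1, case_names one gen inv_gen]:
  assumes "g \<in> carrier (presented_group X R)"
    and "P \<one>\<^bsub>presented_group X R\<^esub>"
    and "\<And>x g. x \<in> X \<Longrightarrow> g \<in> carrier (presented_group X R) \<Longrightarrow> P g \<Longrightarrow>
      P (pres_gen X R x \<otimes>\<^bsub>presented_group X R\<^esub> g)"
    and "\<And>x g. x \<in> X \<Longrightarrow> g \<in> carrier (presented_group X R) \<Longrightarrow> P g \<Longrightarrow>
      P (inv\<^bsub>presented_group X R\<^esub> (pres_gen X R x) \<otimes>\<^bsub>presented_group X R\<^esub> g)"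
  shows "P g"
proof -
  interpret group "presented_group X R" by (rule group_presented_group)
  have "P (word_val (presented_group X R) (pres_gen X R) w)" if "w \<in> group_words X" for w
    using that
  proof (induction w)
    case (Cons l w)
    then show ?case
      using assms(3,4) word_val_closed[of "pres_gen X R" X w]
      by (auto simp: group_words_Cons pres_gen_closed)
  qed (use assms in simp)
  moreover obtain w where "w \<in> group_words X" "g = pres_class X R w"
    using assms(1) by (auto simp: presented_group_def)
  ultimately show ?thesis by (metis word_val_pres_gen)
qed

lemma presented_group_hom_eq:
  assumes "group H" "\<phi> \<in> hom (presented_group X R) H" "\<psi> \<in> hom (presented_group X R) H"
    and eq: "\<And>x. x \<in> X \<Longrightarrow> \<phi> (pres_gen X R x) = \<psi> (pres_gen X R x)"
    and "g \<in> carrier (presented_group X R)"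
  shows "\<phi> g = \<psi> g"
  using assms(5)
proof (induction rule: presented_group_induct)
  case one
  show ?case using assms hom_one group_presented_group by metis
next
  case (gen x g)
  then show ?case using eq by (simp add: hom_mult[OF assms(2)] hom_mult[OF assms(3)] pres_gen_closed)
next
  case (inv_gen x g)
  interpret p: group_hom "presented_group X R" H \<phi>
    using assms group_presented_group by (auto simp: group_hom_def group_hom_axioms_def)
  interpret q: group_hom "presented_group X R" H \<psi>
    using assms group_presented_group by (auto simp: group_hom_def group_hom_axioms_def)
  show ?case using inv_gen eq by (simp add: pres_gen_closed)
qed


section \<open>Subgroups of finite index\<close>

lemma (in group) rcos_eq_iff:
  assumes "subgroup H G" "x \<in> carrier G" "y \<in> carrier G"
  shows "H #> x = H #> y \<longleftrightarrow> x \<otimes> inv y \<in> H"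
proof
  assume eq: "H #> x = H #> y"
  have "x \<in> H #> y" using rcos_self[OF assms(2,1)] eq by simp
  then obtain h where "h \<in> H" "x = h \<otimes> y" by (auto simp: r_coset_def)
  then show "x \<otimes> inv y \<in> H"
    using assms by (simp add: m_assoc subgroup.mem_carrier[OF assms(1)])
next
  assume "x \<otimes> inv y \<in> H"
  then have "H #> (x \<otimes> inv y) = H" using assms by (intro coset_join2) auto
  then show "H #> x = H #> y"
    using assms by (intro coset_mult_inv1) (auto simp: subgroup.subset)
qed

text \<open>All finiteness of indices below comes from an invariant \<open>F\<close> with finitely many values that
  separates the cosets.\<close>

lemma (in group) finite_rcosetsI:
  assumes H: "subgroup H G" and fin: "finite (F ` carrier G)"
    and F: "\<And>x y. x \<in> carrier G \<Longrightarrow> y \<in> carrier G \<Longrightarrow> F x = F y \<Longrightarrow> x \<otimes> inv y \<in> H"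
  shows "finite (rcosets H)"
proof (rule finite_surj[OF fin])
  show "rcosets H \<subseteq> (\<lambda>z. H #> (SOME x. x \<in> carrier G \<and> F x = z)) ` F ` carrier G"
  proof
    fix D assume "D \<in> rcosets H"
    then obtain x where x: "x \<in> carrier G" "D = H #> x" by (auto simp: RCOSETS_def)
    define y where "y = (SOME y. y \<in> carrier G \<and> F y = F x)"
    have "y \<in> carrier G \<and> F y = F x"
      unfolding y_def by (rule someI[of _ x]) (use x in simp)
    then have "D = H #> y" using x F[of x y] rcos_eq_iff[OF H] by simp
    then show "D \<in> (\<lambda>z. H #> (SOME x. x \<in> carrier G \<and> F x = z)) ` F ` carrier G"
      using x y_def by blast
  qed
qed

lemma (in group) finite_rcosets_Int:
  assumes "subgroup H G" "subgroup K G" "finite (rcosets H)" "finite (rcosets K)"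
  shows "finite (rcosets (H \<inter> K))"
proof (rule finite_rcosetsI[where F = "\<lambda>x. (H #> x, K #> x)"])
  show "subgroup (H \<inter> K) G" using assms subgroups_Inter_pair by blast
  have "(\<lambda>x. (H #> x, K #> x)) ` carrier G \<subseteq> (rcosets H) \<times> (rcosets K)"
    by (auto simp: RCOSETS_def)
  then show "finite ((\<lambda>x. (H #> x, K #> x)) ` carrier G)"
    using assms finite_subset by blast
qed (use assms in \<open>auto simp: rcos_eq_iff\<close>)

lemma (in group) finite_rcosets_mono:
  assumes "subgroup H G" "finite (rcosets H)" "subgroup K G" "H \<subseteq> K"
  shows "finite (rcosets K)"
proof (rule finite_rcosetsI[where F = "\<lambda>x. H #> x"])
  show "finite ((\<lambda>x. H #> x) ` carrier G)"
    using assms(2) by (rule rev_finite_subset) (auto simp: RCOSETS_def)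
qed (use assms in \<open>auto simp: rcos_eq_iff\<close>)

lemma (in group) inv_cancel_left:
  assumes "x \<in> carrier G" "y \<in> carrier G"
  shows "inv x \<otimes> (x \<otimes> y) = y" "x \<otimes> (inv x \<otimes> y) = y"
  using assms by (simp_all flip: m_assoc)

lemma (in group) subgroup_nat_pow_closed:
  "subgroup H G \<Longrightarrow> h \<in> H \<Longrightarrow> h [^] (n :: nat) \<in> H"
  using subgroup_int_pow_closed[of H h "int n"] by (simp add: int_pow_int)

lemma (in group) pow_conj:
  assumes "x \<in> carrier G" "g \<in> carrier G"
  shows "(x \<otimes> g \<otimes> inv x) [^] (n::nat) = x \<otimes> g [^] n \<otimes> inv x"
proof (induction n)
  case (Suc n)
  then show ?case using assms by (simp add: m_assoc inv_cancel_left)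
qed (use assms in simp)

text \<open>The cosets \<open>H x g\<^sup>i\<close> cannot all be different; two equal ones yield a power of \<open>g\<close> that is
  conjugated into \<open>H\<close> by \<open>x\<close>.\<close>

lemma (in group) pow_in_finite_index:
  assumes H: "subgroup H G" "finite (rcosets H)" and "x \<in> carrier G" "g \<in> carrier G"
  obtains n where "0 < n" "n \<le> card (rcosets H)" "x \<otimes> g [^] (n::nat) \<otimes> inv x \<in> H"
proof -
  let ?f = "\<lambda>i::nat. H #> (x \<otimes> g [^] i)"
  have sub: "?f ` {0..card (rcosets H)} \<subseteq> rcosets H"
    using assms by (auto intro!: rcosetsI[OF subgroup.subset[OF H(1)]])
  have "\<not> inj_on ?f {0..card (rcosets H)}"
    using card_mono[OF H(2) sub] by (intro pigeonhole) simp
  then obtain i j where "i < j" "j \<le> card (rcosets H)" "?f j = ?f i"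
    unfolding inj_on_def by (metis atLeastAtMost_iff linorder_neqE_nat)
  moreover have "(x \<otimes> g [^] j) \<otimes> inv (x \<otimes> g [^] i) = x \<otimes> g [^] (j - i) \<otimes> inv x" if "i < j"
  proof -
    have "g [^] j = g [^] (j - i) \<otimes> g [^] i" using that assms by (simp add: nat_pow_mult)
    then show ?thesis using assms by (simp add: inv_mult_group m_assoc inv_cancel_left)
  qed
  ultimately show thesis
    using assms rcos_eq_iff[OF H(1), of "x \<otimes> g [^] j" "x \<otimes> g [^] i"] by (intro that[of "j - i"]) auto
qed

text \<open>The exponent found above is at most the index and so divides its factorial. This gives one
  exponent for all \<open>g\<close> and all conjugates simultaneously.\<close>

lemma (in group) pow_fact_in_finite_index:
  assumes H: "subgroup H G" "finite (rcosets H)" and "x \<in> carrier G" "g \<in> carrier G"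
  shows "x \<otimes> g [^] (fact (card (rcosets H)) :: nat) \<otimes> inv x \<in> H"
proof -
  obtain n where n: "0 < n" "n \<le> card (rcosets H)" "x \<otimes> g [^] n \<otimes> inv x \<in> H"
    using pow_in_finite_index[OF assms] .
  then have "n dvd fact (card (rcosets H))" by (intro dvd_fact) auto
  then obtain r where r: "fact (card (rcosets H)) = n * r" by (auto elim: dvdE)
  have "x \<otimes> g [^] (n * r) \<otimes> inv x = (x \<otimes> g [^] n \<otimes> inv x) [^] r"
    using assms by (simp add: pow_conj flip: nat_pow_pow)
  then show ?thesis using n(3) H(1) r by (simp add: subgroup_nat_pow_closed)
qed


section \<open>A criterion for cyclic subgroup separability\<close>

text \<open>Continuity of \<open>c\<close> from the profinite topology of \<open>G\<close> to the profinite topology of \<open>\<int>\<close>, in its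
  uniform form: modulo every \<open>m\<close>, the function \<open>c\<close> factors through a finite quotient of \<open>G\<close>.\<close>

definition profinitely_continuous :: "('a, 'm) monoid_scheme \<Rightarrow> ('a \<Rightarrow> int) \<Rightarrow> bool" where
  "profinitely_continuous G c \<longleftrightarrow> (\<forall>m>0. \<exists>N. N \<lhd> G \<and> finite (rcosets\<^bsub>G\<^esub> N) \<and>
     (\<forall>x\<in>carrier G. \<forall>y\<in>carrier G. x \<otimes>\<^bsub>G\<^esub> inv\<^bsub>G\<^esub> y \<in> N \<longrightarrow> m dvd c x - c y))"

text \<open>Let \<open>h\<close> be a limit of powers of \<open>g\<close>: in each finite quotient it agrees with some \<open>g\<^sup>k\<close>, where
  \<open>k\<close> depends on the quotient. If \<open>c\<close> is continuous with \<open>c (g\<^sup>k) = k \<cdot> c g\<close>, then \<open>c h\<close> is congruent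
  to \<open>k \<cdot> c g\<close> modulo any prescribed integer, so \<open>c h = l \<cdot> c g\<close> for an integer \<open>l\<close>, and the
  exponents \<open>k\<close> converge to \<open>l\<close>; hence \<open>h = g\<^sup>l\<close>. The same functions show that the finite quotients
  separate points, since a nontrivial \<open>g\<close> has \<open>c g \<noteq> 0 = c \<one>\<close>. The formulation leaves room for
  functions that depend on \<open>g\<close> and are additive only on its powers, such as Magnus coefficients.\<close>

lemma (in group) cyclic_subgroup_separableI:
  assumes sep: "\<And>g. g \<in> carrier G \<Longrightarrow> g \<noteq> \<one> \<Longrightarrow>
    \<exists>c. profinitely_continuous G c \<and> c g \<noteq> 0 \<and> (\<forall>k::int. c (g [^] k) = k * c g)"
  shows "cyclic_subgroup_separable G"
proof -
  have residually_finite: "\<exists>N. N \<lhd> G \<and> finite (rcosets N) \<and> x \<notin> N"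
    if x: "x \<in> carrier G" "x \<noteq> \<one>" for x
  proof -
    obtain c where c: "profinitely_continuous G c" "c x \<noteq> 0" "\<And>k::int. c (x [^] k) = k * c x"
      using sep[OF x] by blast
    have pos: "0 < \<bar>c x\<bar> + 1" by simp
    obtain N where N: "N \<lhd> G" "finite (rcosets N)"
      "\<And>u v. u \<in> carrier G \<Longrightarrow> v \<in> carrier G \<Longrightarrow> u \<otimes> inv v \<in> N \<Longrightarrow> \<bar>c x\<bar> + 1 dvd c u - c v"
      using c(1) pos unfolding profinitely_continuous_def by blast
    have "c \<one> = 0" using c(3)[of 0] by simp
    then have "\<not> \<bar>c x\<bar> + 1 dvd c x - c \<one>"
      using c(2) dvd_imp_le_int[of "c x" "\<bar>c x\<bar> + 1"] by auto
    then have "x \<notin> N" using N(3)[of x \<one>] x by auto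
    then show ?thesis using N by blast
  qed
  have closed: "h \<in> generate G {g}"
    if g: "g \<in> carrier G" and h: "h \<in> carrier G"
      and limit: "\<And>N. N \<lhd> G \<Longrightarrow> finite (rcosets N) \<Longrightarrow> \<exists>k::int. h \<otimes> inv (g [^] k) \<in> N" for g h
  proof (cases "g = \<one>")
    case True
    then have "h \<in> N" if "N \<lhd> G" "finite (rcosets N)" for N
      using limit[OF that] h by simp
    then have "h = \<one>" using residually_finite[OF h] by blast
    then show ?thesis by (simp add: generate.one)
  next
    case False
    obtain c where c: "profinitely_continuous G c" "c g \<noteq> 0" "\<And>k::int. c (g [^] k) = k * c g"
      using sep[OF g False] by blast
    have cont: "\<exists>N. N \<lhd> G \<and> finite (rcosets N) \<and>
        (\<forall>k::int. h \<otimes> inv (g [^] k) \<in> N \<longrightarrow> m dvd c h - k * c g)" if "m > 0" for m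
    proof -
      obtain N where "N \<lhd> G" "finite (rcosets N)"
        "\<forall>u\<in>carrier G. \<forall>v\<in>carrier G. u \<otimes> inv v \<in> N \<longrightarrow> m dvd c u - c v"
        using c(1) \<open>m > 0\<close> unfolding profinitely_continuous_def by blast
      then show ?thesis using g h c(3) by (metis int_pow_closed)
    qed
    \<comment> \<open>Take a quotient in which \<open>c\<close> is determined modulo \<open>c g\<close>.\<close>
    have "c g dvd c h"
    proof -
      obtain N where N: "N \<lhd> G" "finite (rcosets N)"
        "\<And>k::int. h \<otimes> inv (g [^] k) \<in> N \<Longrightarrow> \<bar>c g\<bar> dvd c h - k * c g"
        using cont[of "\<bar>c g\<bar>"] c(2) by auto
      obtain k :: int where "h \<otimes> inv (g [^] k) \<in> N" using limit N by blast
      then have "c g dvd c h - k * c g" using N(3) by simp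
      then show ?thesis by (metis dvd_diff_commute dvd_triv_right dvd_diff_right_iff dvd_add_right_iff diff_add_cancel)
    qed
    then obtain l where l: "c h = c g * l" by (elim dvdE)
    let ?x = "h \<otimes> inv (g [^] l)"
    have "?x = \<one>"
    proof (rule ccontr)
      assume "?x \<noteq> \<one>"
      then obtain N where N: "N \<lhd> G" "finite (rcosets N)" "?x \<notin> N"
        using residually_finite[of ?x] g h by auto
      interpret N: normal N G by (fact N(1))
      obtain q where q: "0 < q" "g [^] (q::nat) \<in> N"
        using pow_in_finite_index[OF N.is_subgroup N(2) one_closed g] g by auto
      obtain M where M: "M \<lhd> G" "finite (rcosets M)"
        "\<And>k::int. h \<otimes> inv (g [^] k) \<in> M \<Longrightarrow> \<bar>c g\<bar> * int q dvd c h - k * c g"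
        using cont[of "\<bar>c g\<bar> * int q"] c(2) q by auto
      \<comment> \<open>\<open>M\<close> controls \<open>c\<close> modulo \<open>c g \<cdot> q\<close>, hence the exponent modulo \<open>q\<close>, which is enough to know the
        power of \<open>g\<close> modulo \<open>N\<close>.\<close>
      have "N \<inter> M \<lhd> G" using N M by (simp add: normal_subgroup_intersect)
      moreover have "finite (rcosets (N \<inter> M))"
        using N M by (intro finite_rcosets_Int) (auto dest: normal_imp_subgroup)
      ultimately obtain k :: int where k: "h \<otimes> inv (g [^] k) \<in> N" "h \<otimes> inv (g [^] k) \<in> M"
        using limit by blast
      have "\<bar>c g * int q\<bar> dvd c g * (l - k)"
        using M(3)[OF k(2)] l by (simp add: abs_mult algebra_simps)
      then have "int q dvd k - l" using c(2) by (simp add: dvd_diff_commute)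
      then obtain j where j: "k - l = int q * j" by (elim dvdE)
      have "(g [^] q) [^] j = g [^] (k - l)"
        using g j by (simp add: int_pow_pow flip: int_pow_int)
      then have "g [^] (k - l) \<in> N"
        using subgroup_int_pow_closed[OF N.is_subgroup q(2)] by metis
      then have "h \<otimes> inv (g [^] k) \<otimes> g [^] (k - l) \<in> N" using k(1) by blast
      moreover have "h \<otimes> inv (g [^] k) \<otimes> g [^] (k - l) = ?x"
        using g h by (simp add: m_assoc flip: int_pow_mult int_pow_neg)
      ultimately show False using N(3) by simp
    qed
    then have "h = g [^] l" using g h
      by (metis int_pow_closed inv_closed inv_equality inv_inv)
    then show ?thesis using g by (auto simp: generate_pow)
  qed
  have "separable_subgroup (generate G {g}) G" if g: "g \<in> carrier G" for g
  proof -
    have gen: "subgroup (generate G {g}) G" using g by (intro generate_is_subgroup) simp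
    let ?HH = "{K. finite_index_subgroup K G \<and> generate G {g} \<subseteq> K}"
    have "finite_index_subgroup (carrier G) G"
      unfolding finite_index_subgroup_def
      by (auto intro!: subgroup_self finite_rcosetsI[where F = "\<lambda>_. ()"])
    then have "carrier G \<in> ?HH" using gen by (simp add: subgroup.subset)
    moreover have "\<Inter>?HH \<subseteq> generate G {g}"
    proof
      fix h assume h: "h \<in> \<Inter>?HH"
      show "h \<in> generate G {g}"
      proof (rule closed[OF g])
        show "h \<in> carrier G" using h \<open>carrier G \<in> ?HH\<close> by blast
        fix N assume N: "N \<lhd> G" "finite (rcosets N)"
        let ?K = "N <#> generate G {g}"
        have K: "subgroup ?K G" using mult_norm_subgroup[OF N(1) gen] .
        have N1: "subgroup N G" using normal_imp_subgroup[OF N(1)] .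
        have "n \<in> ?K" if "n \<in> N" for n
        proof -
          have "n \<otimes> \<one> \<in> ?K"
            unfolding set_mult_def using that subgroup.one_closed[OF gen] by blast
          then show ?thesis using that subgroup.mem_carrier[OF N1] by simp
        qed
        then have "N \<subseteq> ?K" by blast
        then have "finite_index_subgroup ?K G"
          using K N finite_rcosets_mono[OF normal_imp_subgroup] by (auto simp: finite_index_subgroup_def)
        moreover have "generate G {g} \<subseteq> ?K"
        proof
          fix x assume x: "x \<in> generate G {g}"
          have "\<one> \<otimes> x \<in> ?K"
            unfolding set_mult_def using x subgroup.one_closed[OF N1] by blast
          then show "x \<in> ?K" using x subgroup.mem_carrier[OF gen] by simp
        qed
        ultimately have "?K \<in> ?HH" by (intro CollectI conjI)
        with h have "h \<in> ?K" by (rule InterD)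
        then obtain n k where "n \<in> N" "h = n \<otimes> g [^] (k::int)"
          using g by (auto simp: set_mult_def generate_pow)
        moreover from this have "n \<in> carrier G"
          using subgroup.mem_carrier[OF N1] by simp
        ultimately show "\<exists>k::int. h \<otimes> inv (g [^] k) \<in> N"
          using g by (intro exI[of _ k]) (simp add: m_assoc)
      qed
    qed
    ultimately show ?thesis
      unfolding separable_subgroup_def using gen by (intro conjI exI[of _ ?HH]) auto
  qed
  then show ?thesis by (simp add: cyclic_subgroup_separable_def)
qed


section \<open>An obstruction to virtual retractions\<close>

text \<open>Here \<open>t\<close>, \<open>a t\<close> and \<open>a\<^sup>2 t\<close> are conjugate, although they lie on a line in the abelian group
  \<open>\<langle>a, t\<rangle>\<close>. A homomorphism \<open>f\<close> on a subgroup \<open>H\<close> of finite index yields the conjugation-invariant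
  function \<open>Q y = \<Sum> (f (x y\<^sup>n x\<inverse>))\<^sup>2\<close>, summed over representatives \<open>x\<close> of the cosets of \<open>H\<close>, where \<open>n\<close>
  is chosen such that all the arguments lie in \<open>H\<close>. On commuting elements each summand is the square
  of an additive function, so \<open>Q\<close> is a positive semidefinite quadratic form there. A convex
  quadratic function that takes the same value at three equidistant points is constant; thus
  \<open>Q a = 0\<close>, which forces \<open>f a = 0\<close>. Summing \<open>f\<close> itself instead of its square would give no
  information, because the contributions of different cosets can cancel.\<close>

lemma (in group) virtual_hom_vanishes:
  fixes f :: "'a \<Rightarrow> int"
  assumes H: "subgroup H G" "finite (rcosets H)"
    and f: "\<And>x y. x \<in> H \<Longrightarrow> y \<in> H \<Longrightarrow> f (x \<otimes> y) = f x + f y"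
    and a: "a \<in> H" and t: "t \<in> carrier G" and comm: "a \<otimes> t = t \<otimes> a"
    and b: "b \<in> carrier G" "b \<otimes> (a \<otimes> t) \<otimes> inv b = t"
    and c: "c \<in> carrier G" "c \<otimes> (a \<otimes> a \<otimes> t) \<otimes> inv c = t"
  shows "f a = 0"
proof -
  define n :: nat where "n = fact (card (rcosets H))"
  have inH: "x \<otimes> g [^] n \<otimes> inv x \<in> H" if "x \<in> carrier G" "g \<in> carrier G" for x g
    unfolding n_def by (rule pow_fact_in_finite_index[OF H that])
  have HG: "x \<in> carrier G" if "x \<in> H" for x using that subgroup.mem_carrier[OF H(1)] by blast
  have f_conj: "f (x \<otimes> y \<otimes> inv x) = f (x' \<otimes> y \<otimes> inv x')"
    if eq: "H #> x = H #> x'" and x: "x \<in> carrier G" "x' \<in> carrier G" "y \<in> carrier G"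
      and z: "x' \<otimes> y \<otimes> inv x' \<in> H" for x x' y
  proof -
    define h where "h = x \<otimes> inv x'"
    have h: "h \<in> H" "inv h \<in> H"
      using eq x rcos_eq_iff[OF H(1)] subgroup.m_inv_closed[OF H(1)] by (auto simp: h_def)
    have "f \<one> = 0" using f[of \<one> \<one>] subgroup.one_closed[OF H(1)] by simp
    then have "f h + f (inv h) = 0" using f[OF h] h HG by simp
    moreover have "x \<otimes> y \<otimes> inv x = h \<otimes> (x' \<otimes> y \<otimes> inv x') \<otimes> inv h"
    proof -
      have "x = h \<otimes> x'" using x by (simp add: h_def m_assoc)
      then show ?thesis using x h HG by (simp add: inv_mult_group m_assoc)
    qed
    ultimately show ?thesis
      using f h z subgroup.m_closed[OF H(1)] by simp
  qed
  define rep where "rep D = (SOME x. x \<in> D)" for D :: "'a set"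
  have rep: "rep D \<in> carrier G" "H #> rep D = D" if D: "D \<in> rcosets H" for D
  proof -
    obtain x where x: "x \<in> carrier G" "D = H #> x" using D by (auto simp: RCOSETS_def)
    then have "x \<in> D" using rcos_self H(1) by blast
    then have *: "rep D \<in> D" unfolding rep_def by (rule someI)
    then show "rep D \<in> carrier G" using x H(1) r_coset_subset_G subgroup.subset by blast
    show "H #> rep D = D" using * x H(1) repr_independence by metis
  qed
  define q where "q y D = f (rep D \<otimes> y [^] n \<otimes> inv (rep D))" for y D
  have q_mult: "q (y \<otimes> z) D = q y D + q z D"
    if "y \<in> carrier G" "z \<in> carrier G" "y \<otimes> z = z \<otimes> y" "D \<in> rcosets H" for y z D
  proof -
    let ?x = "rep D"
    have "?x \<otimes> (y \<otimes> z) [^] n \<otimes> inv ?x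
        = (?x \<otimes> y [^] n \<otimes> inv ?x) \<otimes> (?x \<otimes> z [^] n \<otimes> inv ?x)"
    proof -
      have "(?x \<otimes> y [^] n \<otimes> inv ?x) \<otimes> (?x \<otimes> z [^] n \<otimes> inv ?x)
          = ?x \<otimes> (y [^] n \<otimes> z [^] n) \<otimes> inv ?x"
        using that rep by (simp add: m_assoc inv_cancel_left)
      moreover have "(y \<otimes> z) [^] n = y [^] n \<otimes> z [^] n"
        using that by (intro pow_mult_distrib)
      ultimately show ?thesis by simp
    qed
    then show ?thesis using that rep inH f by (simp add: q_def)
  qed
  define Q where "Q y = (\<Sum>D\<in>rcosets H. (q y D)\<^sup>2)" for y
  have Q_conj: "Q (z \<otimes> y \<otimes> inv z) = Q y" if yz: "y \<in> carrier G" "z \<in> carrier G" for y z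
  proof -
    have D: "D #> z \<in> rcosets H \<and> D #> z #> inv z = D \<and> D #> inv z #> z = D" 
      if "D \<in> rcosets H" "z \<in> carrier G" for D z
      using that subgroup.subset[OF H(1)] by (auto simp: RCOSETS_def coset_mult_assoc m_assoc)
    have bij: "bij_betw (\<lambda>D. D #> z) (rcosets H) (rcosets H)"
      by (rule bij_betw_byWitness[where f' = "\<lambda>D. D #> inv z"])
        (use D yz D[of _ "inv z"] in auto)
    have "q (z \<otimes> y \<otimes> inv z) D = q y (D #> z)" if "D \<in> rcosets H" for D
    proof -
      have Dz: "D #> z \<in> rcosets H" using D that yz by blast
      have "H #> (rep D \<otimes> z) = D #> z"
        using rep[OF that] yz coset_mult_assoc[OF subgroup.subset[OF H(1)], of "rep D" z] by simp
      then have "f ((rep D \<otimes> z) \<otimes> y [^] n \<otimes> inv (rep D \<otimes> z)) = q y (D #> z)"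
        unfolding q_def using rep[OF that] rep[OF Dz] yz inH by (intro f_conj) auto
      moreover have "(rep D \<otimes> z) \<otimes> y [^] n \<otimes> inv (rep D \<otimes> z)
          = rep D \<otimes> (z \<otimes> y \<otimes> inv z) [^] n \<otimes> inv (rep D)"
        using rep[OF that] pow_conj[OF yz(2,1), of n] yz by (simp add: inv_mult_group m_assoc)
      ultimately show ?thesis by (simp add: q_def)
    qed
    then have "Q (z \<otimes> y \<otimes> inv z) = (\<Sum>D\<in>rcosets H. (q y (D #> z))\<^sup>2)" by (simp add: Q_def)
    also have "\<dots> = Q y"
      unfolding Q_def by (rule sum.reindex_bij_betw[OF bij])
    finally show ?thesis .
  qed
  have aG: "a \<in> carrier G" using a HG by blast
  have Qt: "Q (a \<otimes> t) = Q t" "Q (a \<otimes> a \<otimes> t) = Q t"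
    using Q_conj[of "a \<otimes> t" b] Q_conj[of "a \<otimes> a \<otimes> t" c] aG t b c by simp_all
  have "a \<otimes> a \<otimes> t = t \<otimes> (a \<otimes> a)" using aG t comm by (metis m_assoc)
  then have qt: "q (a \<otimes> t) D = q a D + q t D" "q (a \<otimes> a \<otimes> t) D = 2 * q a D + q t D"
    if "D \<in> rcosets H" for D
    using that aG t comm by (simp_all add: q_mult)
  \<comment> \<open>The second difference of the quadratic sequence \<open>Q t, Q (a t), Q (a\<^sup>2 t)\<close> is \<open>2 \<cdot> Q a\<close>.\<close>
  have "2 * Q a = Q (a \<otimes> a \<otimes> t) - 2 * Q (a \<otimes> t) + Q t"
    by (simp add: Q_def qt sum_distrib_left power2_eq_square algebra_simps
        flip: sum.distrib sum_subtractf)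
  then have "Q a = 0" using Qt by simp
  moreover have HH: "H \<in> rcosets H" using subgroup.subgroup_in_rcosets[OF H(1) is_group] .
  ultimately have "q a H = 0" unfolding Q_def using H(2) by (simp add: sum_nonneg_eq_0_iff)
  moreover have "q a H = f (a [^] n)"
    using f_conj[of "rep H" \<one> "a [^] n"] rep[OF HH] aG a H(1)
    by (simp add: q_def subgroup.subset subgroup_nat_pow_closed)
  moreover have "f (a [^] k) = int k * f a" for k :: nat
  proof (induction k)
    case 0
    then show ?case using f[of \<one> \<one>] subgroup.one_closed[OF H(1)] by simp
  next
    case (Suc k)
    then show ?case using f[of "a [^] k" a] a H(1) by (simp add: subgroup_nat_pow_closed algebra_simps)
  qed
  ultimately show ?thesis by (simp add: n_def)
qed


section \<open>The Gersten group\<close>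

definition gersten_rels :: "(gersten_gen letter list \<times> gersten_gen letter list) set" where
  "gersten_rels = {([Gen gen_t, Gen gen_a, Inv gen_t], [Gen gen_a]),
      ([Gen gen_t, Gen gen_b, Inv gen_t], [Gen gen_b, Gen gen_a]),
      ([Gen gen_t, Gen gen_c, Inv gen_t], [Gen gen_c, Gen gen_a, Gen gen_a])}"

text \<open>The generators exhaust their type, so the presentation can be taken over \<open>UNIV\<close>, where the
  side condition on generators becomes trivial.\<close>

lemma UNIV_gersten_gen: "UNIV = {gen_a, gen_b, gen_c, gen_t}"
  using gersten_gen.exhaust by blast

lemma gersten_group_eq: "gersten_group = presented_group UNIV gersten_rels"
  by (simp add: gersten_group_def gersten_rels_def UNIV_gersten_gen)

definition gelt :: "gersten_gen \<Rightarrow> gersten_gen letter list set" where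
  "gelt = pres_gen UNIV gersten_rels"

interpretation GG: group gersten_group
  unfolding gersten_group_eq by (rule group_presented_group)

lemma gelt_closed [simp]: "gelt x \<in> carrier gersten_group"
  unfolding gersten_group_eq gelt_def by (simp add: pres_gen_closed)

lemma (in group) conj_eq_iff:
  assumes "x \<in> carrier G" "y \<in> carrier G" "t \<in> carrier G"
  shows "t \<otimes> (x \<otimes> inv t) = y \<longleftrightarrow> t \<otimes> x = y \<otimes> t"
proof
  assume "t \<otimes> (x \<otimes> inv t) = y"
  then have "y \<otimes> t = t \<otimes> (x \<otimes> inv t) \<otimes> t" by simp
  then show "t \<otimes> x = y \<otimes> t" using assms by (simp add: m_assoc)
next
  assume "t \<otimes> x = y \<otimes> t"
  then have "t \<otimes> x \<otimes> inv t = y \<otimes> t \<otimes> inv t" by simp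
  then show "t \<otimes> (x \<otimes> inv t) = y" using assms by (simp add: m_assoc)
qed

text \<open>The relations in the form in which \<open>t\<close> is moved to the right past a generator.\<close>

lemma gersten_relations:
  "gelt gen_t \<otimes>\<^bsub>gersten_group\<^esub> gelt gen_a = gelt gen_a \<otimes>\<^bsub>gersten_group\<^esub> gelt gen_t"
  "gelt gen_t \<otimes>\<^bsub>gersten_group\<^esub> gelt gen_b
    = gelt gen_b \<otimes>\<^bsub>gersten_group\<^esub> gelt gen_a \<otimes>\<^bsub>gersten_group\<^esub> gelt gen_t"
  "gelt gen_t \<otimes>\<^bsub>gersten_group\<^esub> gelt gen_c
    = gelt gen_c \<otimes>\<^bsub>gersten_group\<^esub> gelt gen_a \<otimes>\<^bsub>gersten_group\<^esub> gelt gen_a \<otimes>\<^bsub>gersten_group\<^esub> gelt gen_t"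
proof -
  have rel: "word_val gersten_group gelt u = word_val gersten_group gelt v"
    if "(u, v) \<in> gersten_rels" for u v
    using presented_group_rel[of u v gersten_rels UNIV] that
    by (auto simp: gersten_group_eq gelt_def group_words_def gersten_rels_def)
  show "gelt gen_t \<otimes>\<^bsub>gersten_group\<^esub> gelt gen_a = gelt gen_a \<otimes>\<^bsub>gersten_group\<^esub> gelt gen_t"
    using rel[of "[Gen gen_t, Gen gen_a, Inv gen_t]" "[Gen gen_a]"]
    by (simp add: gersten_rels_def GG.conj_eq_iff)
  show "gelt gen_t \<otimes>\<^bsub>gersten_group\<^esub> gelt gen_b
    = gelt gen_b \<otimes>\<^bsub>gersten_group\<^esub> gelt gen_a \<otimes>\<^bsub>gersten_group\<^esub> gelt gen_t"
    using rel[of "[Gen gen_t, Gen gen_b, Inv gen_t]" "[Gen gen_b, Gen gen_a]"]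
    by (simp add: gersten_rels_def GG.conj_eq_iff)
  show "gelt gen_t \<otimes>\<^bsub>gersten_group\<^esub> gelt gen_c
    = gelt gen_c \<otimes>\<^bsub>gersten_group\<^esub> gelt gen_a \<otimes>\<^bsub>gersten_group\<^esub> gelt gen_a \<otimes>\<^bsub>gersten_group\<^esub> gelt gen_t"
    using rel[of "[Gen gen_t, Gen gen_c, Inv gen_t]" "[Gen gen_c, Gen gen_a, Gen gen_a]"]
    by (simp add: gersten_rels_def GG.conj_eq_iff GG.m_assoc)
qed

lemma (in group) gersten_von_dyck:
  assumes f: "\<And>x. f x \<in> carrier G"
    and "f gen_t \<otimes> f gen_a = f gen_a \<otimes> f gen_t"
    and "f gen_t \<otimes> f gen_b = f gen_b \<otimes> f gen_a \<otimes> f gen_t"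
    and "f gen_t \<otimes> f gen_c = f gen_c \<otimes> f gen_a \<otimes> f gen_a \<otimes> f gen_t"
  obtains \<phi> where "\<phi> \<in> hom gersten_group G" and "\<And>x. \<phi> (gelt x) = f x"
proof (rule von_dyck[of f UNIV gersten_rels])
  show "f \<in> UNIV \<rightarrow> carrier G" using f by simp
  show "word_val G f u = word_val G f v" if "(u, v) \<in> gersten_rels" for u v
    using that assms by (auto simp: gersten_rels_def conj_eq_iff m_assoc)
qed (use that in \<open>auto simp: gersten_group_eq gelt_def\<close>)

lemma gersten_hom_eq:
  assumes "group H" "\<phi> \<in> hom gersten_group H" "\<psi> \<in> hom gersten_group H"
    and "\<And>x. \<phi> (gelt x) = \<psi> (gelt x)" and "g \<in> carrier gersten_group"
  shows "\<phi> g = \<psi> g"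
  using presented_group_hom_eq[of H \<phi> UNIV gersten_rels \<psi> g] assms
  by (simp add: gersten_group_eq gelt_def)

lemma gersten_induct [consumes 1, case_names one gen inv_gen]:
  assumes "g \<in> carrier gersten_group"
    and "P \<one>\<^bsub>gersten_group\<^esub>"
    and "\<And>x g. g \<in> carrier gersten_group \<Longrightarrow> P g \<Longrightarrow> P (gelt x \<otimes>\<^bsub>gersten_group\<^esub> g)"
    and "\<And>x g. g \<in> carrier gersten_group \<Longrightarrow> P g \<Longrightarrow> P (inv\<^bsub>gersten_group\<^esub> (gelt x) \<otimes>\<^bsub>gersten_group\<^esub> g)"
  shows "P g"
  using presented_group_induct[of g UNIV gersten_rels P] assms
  unfolding gersten_group_eq gelt_def by blast


section \<open>The Gersten group is tubular\<close>

lemma (in group) int_pow_conj: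
  assumes "x \<in> carrier G" "g \<in> carrier G"
  shows "(x \<otimes> g \<otimes> inv x) [^] (k::int) = x \<otimes> g [^] k \<otimes> inv x"
proof (cases k rule: int_cases2)
  case (nonneg n)
  then show ?thesis using pow_conj[OF assms] by (simp add: int_pow_int)
next
  case (nonpos n)
  have "inv (x \<otimes> g [^] n \<otimes> inv x) = x \<otimes> inv (g [^] n) \<otimes> inv x"
    using assms by (simp add: inv_mult_group m_assoc)
  then show ?thesis using nonpos assms by (simp add: int_pow_neg int_pow_int pow_conj)
qed

lemma (in group) int_pow_commute:
  assumes "x \<in> carrier G" "y \<in> carrier G" "x \<otimes> y = y \<otimes> x"
  shows "x [^] (i::int) \<otimes> y [^] (j::int) = y [^] j \<otimes> x [^] i"
proof -
  have *: "u [^] (k::int) \<otimes> v = v \<otimes> u [^] k"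
    if "u \<in> carrier G" "v \<in> carrier G" "u \<otimes> v = v \<otimes> u" for u v k
  proof -
    have "v \<otimes> u \<otimes> inv v = u" using that conj_eq_iff[of u u v] by (simp add: m_assoc)
    then have "v \<otimes> u [^] k \<otimes> inv v = u [^] k" using int_pow_conj[of v u k] that by simp
    then show ?thesis using that conj_eq_iff[of "u [^] k" "u [^] k" v] by (simp add: m_assoc)
  qed
  show ?thesis using assms * by (metis int_pow_closed)
qed

text \<open>The relations \<open>t b t\<inverse> = b a\<close> and \<open>t c t\<inverse> = c a\<^sup>2\<close> say \<open>b (a t) b\<inverse> = t\<close> and \<open>c (a\<^sup>2 t) c\<inverse> = t\<close>. So \<open>G\<close>
  arises from \<open>\<langle>a, t\<rangle> \<cong> \<int>\<^sup>2\<close>, with \<open>(i, j)\<close> standing for \<open>a\<^sup>i t\<^sup>j\<close>, by adjoining the two stable letters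
  \<open>b\<close> and \<open>c\<close>, which become the loops \<open>0\<close> and \<open>1\<close>.\<close>

definition gersten_graph :: "(nat, nat, int \<times> int, int) graph_of_groups" where
  "gersten_graph =
     \<lparr>underlying = \<lparr>verts = {0}, arcs = {0, 1}, tail = \<lambda>_. 0, head = \<lambda>_. 0\<rparr>,
      vertex_group = \<lambda>_. integer_group \<times>\<times> integer_group,
      edge_group = \<lambda>_. integer_group,
      tail_map = \<lambda>_ x. (0, x),
      head_map = \<lambda>e x. ((int e + 1) * x, x)\<rparr>"

lemma finite_gersten_graph: "finite_graph_of_groups gersten_graph"
proof -
  have "fin_digraph (underlying gersten_graph)"
    by unfold_locales (auto simp: gersten_graph_def)
  moreover have "connected (underlying gersten_graph)"
    unfolding connected_def strongly_connected_def
    by (auto simp: gersten_graph_def reachable_def intro!: rtrancl_on.intros)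
  moreover have "group (integer_group \<times>\<times> integer_group)"
    by (simp add: DirProd_group)
  ultimately show ?thesis
    unfolding finite_graph_of_groups_def Let_def
    by (auto simp: gersten_graph_def mon_def hom_def DirProd_def inj_on_def algebra_simps)
qed

abbreviation path_group :: "(nat, nat, int \<times> int) path_gen letter list set monoid" where
  "path_group \<equiv> presented_group (path_gens gersten_graph) (path_rels gersten_graph)"

abbreviation path_elt :: "(nat, nat, int \<times> int) path_gen \<Rightarrow> (nat, nat, int \<times> int) path_gen letter list set" where
  "path_elt \<equiv> pres_gen (path_gens gersten_graph) (path_rels gersten_graph)"

interpretation PG: group path_group
  by (rule group_presented_group)

lemma path_gens_iff [simp]:
  "At v p \<in> path_gens gersten_graph \<longleftrightarrow> v = 0"
  "Along e \<in> path_gens gersten_graph \<longleftrightarrow> e = 0 \<or> e = Suc 0"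
  by (auto simp: path_gens_def gersten_graph_def)

lemma path_gens_cases:
  assumes "x \<in> path_gens gersten_graph"
  obtains i j where "x = At 0 (i, j)" | e where "x = Along e" "e = 0 \<or> e = Suc 0"
  using assms by (cases x) auto

lemma path_rels_cases:
  assumes "(u, v) \<in> path_rels gersten_graph"
  obtains i j i' j' where "u = [Gen (At 0 (i, j)), Gen (At 0 (i', j'))]"
      "v = [Gen (At 0 (i + i', j + j'))]"
    | e x where "e = 0 \<or> e = Suc 0"
      "u = [Gen (Along e), Gen (At 0 ((int e + 1) * x, x)), Inv (Along e)]"
      "v = [Gen (At 0 (0, x))]"
  using assms unfolding path_rels_def
proof (elim UnE CollectE exE conjE)
  fix w g h
  assume "(u, v) = ([Gen (At w g), Gen (At w h)],
      [Gen (At w (g \<otimes>\<^bsub>vertex_group gersten_graph w\<^esub> h))])"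
    and "w \<in> verts (underlying gersten_graph)"
  then show thesis
    by (intro that(1)[of "fst g" "snd g" "fst h" "snd h"])
      (simp_all add: gersten_graph_def DirProd_def split: prod.splits)
next
  fix e x
  assume "(u, v) = ([Gen (Along e), Gen (At (head (underlying gersten_graph) e)
        (head_map gersten_graph e x)), Inv (Along e)],
      [Gen (At (tail (underlying gersten_graph) e) (tail_map gersten_graph e x))])"
    and "e \<in> arcs (underlying gersten_graph)"
  then show thesis
    by (intro that(2)[of e x]) (simp_all add: gersten_graph_def)
qed

lemma path_elt_closed [simp]:
  "path_elt (At 0 p) \<in> carrier path_group"
  "path_elt (Along 0) \<in> carrier path_group"
  "path_elt (Along (Suc 0)) \<in> carrier path_group"
  by (simp_all add: pres_gen_closed)

lemma path_elt_At_mult: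
  "path_elt (At 0 (i, j)) \<otimes>\<^bsub>path_group\<^esub> path_elt (At 0 (i', j')) = path_elt (At 0 (i + i', j + j'))"
proof -
  have "([Gen (At 0 (i, j)), Gen (At 0 (i', j'))], [Gen (At 0 (i + i', j + j'))])
      \<in> path_rels gersten_graph"
    unfolding path_rels_def
    by (intro UnI1 CollectI exI[of _ 0] exI[of _ "(i, j)"] exI[of _ "(i', j')"])
      (auto simp: gersten_graph_def)
  from presented_group_rel[OF this, of "path_gens gersten_graph"] show ?thesis
    by simp
qed

lemma path_elt_Along:
  assumes "e = 0 \<or> e = Suc 0"
  shows "path_elt (Along e) \<otimes>\<^bsub>path_group\<^esub> path_elt (At 0 ((int e + 1) * x, x))
    = path_elt (At 0 (0, x)) \<otimes>\<^bsub>path_group\<^esub> path_elt (Along e)"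
proof -
  have "([Gen (Along e), Gen (At 0 ((int e + 1) * x, x)), Inv (Along e)], [Gen (At 0 (0, x))])
      \<in> path_rels gersten_graph"
    unfolding path_rels_def using assms
    by (intro UnI2 CollectI exI[of _ e] exI[of _ x]) (auto simp: gersten_graph_def)
  note rel = presented_group_rel[OF this, of "path_gens gersten_graph"]
  have e: "path_elt (Along e) \<in> carrier path_group" using assms by (intro pres_gen_closed) simp
  have "path_elt (Along e) \<otimes>\<^bsub>path_group\<^esub>
      (path_elt (At 0 ((int e + 1) * x, x)) \<otimes>\<^bsub>path_group\<^esub> inv\<^bsub>path_group\<^esub> (path_elt (Along e)))
    = path_elt (At 0 (0, x))"
    using rel e assms by simp
  then show ?thesis using e by (subst (asm) PG.conj_eq_iff) simp_all
qed

text \<open>With a single vertex every word describes a closed path, up to replacing the inverse of a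
  letter from the vertex group by the letter of the inverse element; so passing to closed paths
  does not shrink the path group.\<close>

lemma fundamental_group_gersten_graph: "fundamental_group gersten_graph 0 = path_group"
proof -
  let ?X = "path_gens gersten_graph" and ?R = "path_rels gersten_graph"
  have words: "w \<in> group_words ?X" if "path_word gersten_graph u w v" for u v w
    using that by induction (auto simp: path_gens_def)
  have "\<exists>w. path_word gersten_graph 0 w 0 \<and> g = pres_class ?X ?R w" if "g \<in> carrier path_group" for g
    using that
  proof (induction rule: presented_group_induct)
    case one
    show ?case
      by (intro exI[of _ "[]"]) (auto simp: presented_group_def gersten_graph_def intro: path_word.Nil)
  next
    case (gen x g)
    then obtain w where w: "path_word gersten_graph 0 w 0" "g = pres_class ?X ?R w" by blast
    have "path_word gersten_graph 0 (Gen x # w) 0"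
      using gen(1)
    proof (cases x rule: path_gens_cases)
      case (1 i j)
      then show ?thesis
        using w(1) path_word.At[of 0 gersten_graph "(i, j)" w 0] by (simp add: gersten_graph_def)
    next
      case (2 e)
      then show ?thesis
        using w(1) path_word.Forward[of e gersten_graph w 0] by (auto simp: gersten_graph_def)
    qed
    moreover have "path_elt x \<otimes>\<^bsub>path_group\<^esub> g = pres_class ?X ?R (Gen x # w)"
      using presented_group_mult[of "[Gen x]" ?X w ?R] gen(1) words[OF w(1)] w(2)
      by (simp add: pres_gen_def)
    ultimately show ?case by blast
  next
    case (inv_gen x g)
    then obtain w where w: "path_word gersten_graph 0 w 0" "g = pres_class ?X ?R w" by blast
    show ?case
      using inv_gen(1)
    proof (cases x rule: path_gens_cases)
      case x: (1 i j)
      let ?y = "At 0 (- i, - j) :: (nat, nat, int \<times> int) path_gen"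
      have "path_elt (At 0 (0, 0)) = \<one>\<^bsub>path_group\<^esub>"
        using path_elt_At_mult[of 0 0 0 0] PG.l_cancel_one by simp
      then have "inv\<^bsub>path_group\<^esub> (path_elt x) = path_elt ?y"
        using path_elt_At_mult[of "- i" "- j" i j] by (intro PG.inv_equality) (simp_all add: x)
      moreover have "path_word gersten_graph 0 (Gen ?y # w) 0"
        using w(1) path_word.At[of 0 gersten_graph _ w 0] by (auto simp: gersten_graph_def)
      moreover have "path_elt ?y \<otimes>\<^bsub>path_group\<^esub> g = pres_class ?X ?R (Gen ?y # w)"
        using presented_group_mult[of "[Gen ?y]" ?X w ?R] words[OF w(1)] w(2)
        by (simp add: pres_gen_def)
      ultimately show ?thesis by auto
    next
      case (2 e)
      then have "path_word gersten_graph 0 (Inv x # w) 0"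
        using w(1) path_word.Backward[of e gersten_graph w 0] by (auto simp: gersten_graph_def)
      moreover have "inv\<^bsub>path_group\<^esub> (path_elt x) \<otimes>\<^bsub>path_group\<^esub> g = pres_class ?X ?R (Inv x # w)"
        using presented_group_mult[of "[Inv x]" ?X w ?R] inv_gen(1) words[OF w(1)] w(2)
        by (simp add: pres_class_letter)
      ultimately show ?thesis by blast
    qed
  qed
  then have "pres_class ?X ?R ` {w. path_word gersten_graph 0 w 0} = carrier path_group"
  proof (intro equalityI subsetI)
    fix g assume "g \<in> pres_class ?X ?R ` {w. path_word gersten_graph 0 w 0}"
    then show "g \<in> carrier path_group" using words by (auto simp: presented_group_def)
  qed blast
  then show ?thesis by (simp add: fundamental_group_def)
qed

text \<open>Both groups are given by presentations, so it suffices to send the generators of each to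
  elements of the other that satisfy the relations, and to check that the two homomorphisms are
  mutually inverse on generators.\<close>

lemma gersten_group_iso_path_group: "gersten_group \<cong> path_group"
proof -
  define f :: "gersten_gen \<Rightarrow> (nat, nat, int \<times> int) path_gen letter list set" where
    "f = case_gersten_gen (path_elt (At 0 (1, 0))) (path_elt (Along 0)) (path_elt (Along 1))
      (path_elt (At 0 (0, 1)))"
  obtain \<phi> where \<phi>: "\<phi> \<in> hom gersten_group path_group" "\<And>x. \<phi> (gelt x) = f x"
  proof (rule PG.gersten_von_dyck)
    show "f x \<in> carrier path_group" for x by (cases x) (simp_all add: f_def)
    show "f gen_t \<otimes>\<^bsub>path_group\<^esub> f gen_a = f gen_a \<otimes>\<^bsub>path_group\<^esub> f gen_t"
      by (simp add: f_def path_elt_At_mult)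
    show "f gen_t \<otimes>\<^bsub>path_group\<^esub> f gen_b
        = f gen_b \<otimes>\<^bsub>path_group\<^esub> f gen_a \<otimes>\<^bsub>path_group\<^esub> f gen_t"
      using path_elt_Along[of 0 1] by (simp add: f_def PG.m_assoc path_elt_At_mult)
    show "f gen_t \<otimes>\<^bsub>path_group\<^esub> f gen_c
        = f gen_c \<otimes>\<^bsub>path_group\<^esub> f gen_a \<otimes>\<^bsub>path_group\<^esub> f gen_a \<otimes>\<^bsub>path_group\<^esub> f gen_t"
      using path_elt_Along[of 1 1] by (simp add: f_def PG.m_assoc path_elt_At_mult)
  qed (rule that)
  let ?a = "gelt gen_a" and ?b = "gelt gen_b" and ?c = "gelt gen_c" and ?t = "gelt gen_t"
  define h :: "(nat, nat, int \<times> int) path_gen \<Rightarrow> gersten_gen letter list set" where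
    "h x = (case x of At v p \<Rightarrow> ?a [^]\<^bsub>gersten_group\<^esub> fst p \<otimes>\<^bsub>gersten_group\<^esub> ?t [^]\<^bsub>gersten_group\<^esub> snd p
      | Along e \<Rightarrow> if e = 0 then ?b else ?c)" for x
  have h_closed: "h x \<in> carrier gersten_group" for x
    by (cases x) (simp_all add: h_def)
  note comm = gersten_relations(1)[symmetric]
  have h_mult: "h (At v (i, j)) \<otimes>\<^bsub>gersten_group\<^esub> h (At v (i', j')) = h (At v (i + i', j + j'))"
    for v i j i' j'
  proof -
    have "?t [^]\<^bsub>gersten_group\<^esub> j \<otimes>\<^bsub>gersten_group\<^esub> (?a [^]\<^bsub>gersten_group\<^esub> i' \<otimes>\<^bsub>gersten_group\<^esub> ?t [^]\<^bsub>gersten_group\<^esub> j')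
       = ?a [^]\<^bsub>gersten_group\<^esub> i' \<otimes>\<^bsub>gersten_group\<^esub> (?t [^]\<^bsub>gersten_group\<^esub> j \<otimes>\<^bsub>gersten_group\<^esub> ?t [^]\<^bsub>gersten_group\<^esub> j')"
      using GG.int_pow_commute[OF _ _ comm, of i' j] by (simp flip: GG.m_assoc)
    then show ?thesis
      by (simp add: h_def GG.m_assoc GG.int_pow_mult)
  qed
  have h_edge: "h (Along e) \<otimes>\<^bsub>gersten_group\<^esub> h (At v ((int e + 1) * x, x)) = h (At v (0, x)) \<otimes>\<^bsub>gersten_group\<^esub> h (Along e)"
    if "e = 0 \<or> e = Suc 0" for v e x
  proof -
    let ?y = "?a [^]\<^bsub>gersten_group\<^esub> (int e + 1) \<otimes>\<^bsub>gersten_group\<^esub> ?t"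
    have a2: "?a [^]\<^bsub>gersten_group\<^esub> (2::int) = ?a \<otimes>\<^bsub>gersten_group\<^esub> ?a"
      using GG.int_pow_mult[of ?a 1 1] by simp
    have "h (Along e) \<otimes>\<^bsub>gersten_group\<^esub> ?y = ?t \<otimes>\<^bsub>gersten_group\<^esub> h (Along e)"
      using that gersten_relations(2,3) by (auto simp: h_def a2 GG.m_assoc)
    then have "h (Along e) \<otimes>\<^bsub>gersten_group\<^esub> ?y \<otimes>\<^bsub>gersten_group\<^esub> inv\<^bsub>gersten_group\<^esub> h (Along e) = ?t"
      using h_closed by (simp add: GG.m_assoc)
    then have "h (Along e) \<otimes>\<^bsub>gersten_group\<^esub> ?y [^]\<^bsub>gersten_group\<^esub> x \<otimes>\<^bsub>gersten_group\<^esub> inv\<^bsub>gersten_group\<^esub> h (Along e)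
        = ?t [^]\<^bsub>gersten_group\<^esub> x"
      using GG.int_pow_conj[of "h (Along e)" ?y x] h_closed by simp
    moreover have "?y [^]\<^bsub>gersten_group\<^esub> x = ?a [^]\<^bsub>gersten_group\<^esub> ((int e + 1) * x) \<otimes>\<^bsub>gersten_group\<^esub> ?t [^]\<^bsub>gersten_group\<^esub> x"
      using GG.int_pow_commute[OF _ _ comm, of "int e + 1" 1]
      by (subst GG.int_pow_mult_distrib) (simp_all add: GG.int_pow_pow)
    ultimately show ?thesis
      using h_closed[of "Along e"] GG.inv_solve_right[of "?t [^]\<^bsub>gersten_group\<^esub> x"]
      by (simp add: h_def[of "At _ _"] GG.inv_solve_right')
  qed
  obtain \<psi> where \<psi>: "\<psi> \<in> hom path_group gersten_group"
    "\<And>x. x \<in> path_gens gersten_graph \<Longrightarrow> \<psi> (path_elt x) = h x"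
  proof (rule GG.von_dyck)
    show "h \<in> path_gens gersten_graph \<rightarrow> carrier gersten_group" using h_closed by simp
    show "word_val gersten_group h u = word_val gersten_group h v"
      if "(u, v) \<in> path_rels gersten_graph" for u v
      using that
    proof (cases rule: path_rels_cases)
      case (1 i j i' j')
      then show ?thesis using h_mult h_closed by simp
    next
      case (2 e x)
      then show ?thesis
        using h_edge[of e 0 x] h_closed by (simp add: GG.conj_eq_iff del: of_nat_add)
    qed
  qed (rule that)
  have "\<psi> (\<phi> g) = g" if "g \<in> carrier gersten_group" for g
  proof -
    have "(\<psi> \<circ> \<phi>) g = id g"
    proof (rule gersten_hom_eq[OF GG.is_group _ _ _ that])
      show "\<psi> \<circ> \<phi> \<in> hom gersten_group gersten_group" using \<phi>(1) \<psi>(1) by (rule hom_compose)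
      show "id \<in> hom gersten_group gersten_group" by (simp add: hom_def)
      show "(\<psi> \<circ> \<phi>) (gelt x) = id (gelt x)" for x
        by (cases x) (simp_all add: \<phi> f_def \<psi> h_def)
    qed
    then show ?thesis by simp
  qed
  moreover have "\<phi> (\<psi> g) = g" if "g \<in> carrier path_group" for g
  proof -
    interpret \<phi>: group_hom gersten_group path_group \<phi>
      using \<phi>(1) by unfold_locales
    have pow: "path_elt (At 0 (1, 0)) [^]\<^bsub>path_group\<^esub> i = path_elt (At 0 (i, 0))"
        "path_elt (At 0 (0, 1)) [^]\<^bsub>path_group\<^esub> i = path_elt (At 0 (0, i))" for i :: int
    proof -
      have "(\<lambda>i. path_elt (At 0 (i, 0))) \<in> hom integer_group path_group"
        "(\<lambda>i. path_elt (At 0 (0, i))) \<in> hom integer_group path_group"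
        by (auto intro!: homI simp: path_elt_At_mult)
      from this[THEN hom_int_pow, of 1 i]
      show "path_elt (At 0 (1, 0)) [^]\<^bsub>path_group\<^esub> i = path_elt (At 0 (i, 0))"
        "path_elt (At 0 (0, 1)) [^]\<^bsub>path_group\<^esub> i = path_elt (At 0 (0, i))" 
        by simp_all
    qed
    have "(\<phi> \<circ> \<psi>) g = id g"
    proof (rule presented_group_hom_eq[OF PG.is_group _ _ _ that])
      show "\<phi> \<circ> \<psi> \<in> hom path_group path_group" using \<psi>(1) \<phi>(1) by (rule hom_compose)
      show "id \<in> hom path_group path_group" by (simp add: hom_def)
      show "(\<phi> \<circ> \<psi>) (path_elt x) = id (path_elt x)" if "x \<in> path_gens gersten_graph" for x
        using that
      proof (cases x rule: path_gens_cases)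
        case (1 i j)
        then show ?thesis
          using \<psi>(2)[OF that] by (simp add: h_def \<phi>(2) f_def \<phi>.hom_int_pow pow path_elt_At_mult)
      next
        case (2 e)
        then show ?thesis
          using \<psi>(2)[OF that] by (auto simp: h_def \<phi>(2) f_def)
      qed
    qed
    then show ?thesis by simp
  qed
  ultimately have "bij_betw \<phi> (carrier gersten_group) (carrier path_group)"
    using \<phi>(1) \<psi>(1) by (intro bij_betw_byWitness[where f' = \<psi>]) (auto simp: hom_def)
  then show ?thesis using \<phi>(1) by (auto simp: is_iso_def iso_def)
qed

lemma tubular_gersten_group: "tubular_group gersten_group"
  unfolding tubular_group_def
proof (intro conjI exI)
  show "finite_graph_of_groups gersten_graph" by (rule finite_gersten_graph)
  show "gersten_group \<cong> fundamental_group gersten_graph 0"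
    using gersten_group_iso_path_group by (simp add: fundamental_group_gersten_graph)
qed (auto simp: GG.is_group gersten_graph_def intro: iso_refl)


section \<open>The Magnus module\<close>

text \<open>A function on words is a formal power series in noncommuting variables with integer
  coefficients, the value at \<open>s\<close> being the coefficient of the monomial \<open>s\<close>. Magnus represents the
  free group on these series by letting a generator \<open>x\<close> act as left multiplication by \<open>1 + x\<close>. The
  automorphism by which \<open>t\<close> acts on the free group extends to the series as a substitution, and
  together they make the ring of series a module over the whole Gersten group. The index type
  is shared with the generators of the group, and the substitution fixes the variable \<open>gen_t\<close>.\<close>

type_synonym 'x series = "'x list \<Rightarrow> int"

text \<open>A series \<open>f\<close> is determined by its constant term and the series \<open>deriv y f\<close>, since
  \<open>f = f [] + (\<Sum>y. y \<cdot> deriv y f)\<close>. Nearly all identities below are checked by comparing these data.\<close>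

definition deriv :: "'x \<Rightarrow> 'x series \<Rightarrow> 'x series" where
  "deriv y f = (\<lambda>s. f (y # s))"

text \<open>Left multiplication by \<open>1 + x\<close>.\<close>

definition mag_mult :: "'x \<Rightarrow> 'x series \<Rightarrow> 'x series" where
  "mag_mult x f = (\<lambda>s. case s of [] \<Rightarrow> f [] | y # s' \<Rightarrow> f s + (if x = y then f s' else 0))"

text \<open>Left multiplication by \<open>1 - x + x\<^sup>2 - \<dots>\<close>, the inverse of \<open>1 + x\<close>.\<close>

primrec mag_div :: "'x \<Rightarrow> 'x series \<Rightarrow> 'x series" where
  "mag_div x f [] = f []"
| "mag_div x f (y # s) = f (y # s) - (if x = y then mag_div x f s else 0)"

lemma series_eqI: "f [] = g [] \<Longrightarrow> (\<And>y. deriv y f = deriv y g) \<Longrightarrow> f = g"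
proof
  fix s assume "f [] = g []" "\<And>y. deriv y f = deriv y g"
  then show "f s = g s" by (cases s) (auto simp: deriv_def fun_eq_iff)
qed

lemma deriv_add [simp]: "deriv y (f + g) = deriv y f + deriv y g"
  by (simp add: deriv_def fun_eq_iff)

lemma mag_mult_Nil [simp]: "mag_mult x f [] = f []"
  by (simp add: mag_mult_def)

lemma deriv_mag_mult [simp]: "deriv y (mag_mult x f) = deriv y f + (if x = y then f else 0)"
  by (simp add: deriv_def mag_mult_def fun_eq_iff)

lemma deriv_mag_div [simp]: "deriv y (mag_div x f) = deriv y f - (if x = y then mag_div x f else 0)"
  by (simp add: deriv_def fun_eq_iff)

lemma mag_mult_add: "mag_mult x (f + g) = mag_mult x f + mag_mult x g"
  by (rule series_eqI) auto

lemma mag_mult_div [simp]: "mag_mult x (mag_div x f) = f"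
  by (rule series_eqI) auto

lemma mag_div_mult [simp]: "mag_div x (mag_mult x f) = f"
proof
  show "mag_div x (mag_mult x f) s = f s" for s
    by (induction s) (auto simp: mag_mult_def)
qed

lemma mag_div_add: "mag_div x (f + g) = mag_div x f + mag_div x g"
  by (metis mag_mult_add mag_mult_div mag_div_mult)

text \<open>The map that keeps the constant term and satisfies
  \<open>deriv y (unfold f) = unfold (E y f)\<close>.\<close>

primrec unfold_series :: "('x \<Rightarrow> 'x series \<Rightarrow> 'x series) \<Rightarrow> 'x list \<Rightarrow> 'x series \<Rightarrow> int" where
  "unfold_series E [] f = f []"
| "unfold_series E (y # s) f = unfold_series E s (E y f)"

text \<open>The substitution \<open>1 + a \<mapsto> 1 + a\<close>, \<open>1 + b \<mapsto> (1 + b) (1 + a)\<close>, \<open>1 + c \<mapsto> (1 + c) (1 + a)\<^sup>2\<close> sends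
  \<open>b\<close> to \<open>a + b (1 + a)\<close> and \<open>c\<close> to \<open>a + a (1 + a) + c (1 + a)\<^sup>2\<close>. Collecting terms by
  their first letter gives the derivatives of the substituted series. Since the substitution fixes
  \<open>a\<close>, the factors \<open>1 + a\<close> can be multiplied in before substituting.\<close>

fun twist_step :: "gersten_gen \<Rightarrow> gersten_gen series \<Rightarrow> gersten_gen series" where
  "twist_step gen_a f = deriv gen_a f + deriv gen_b f + deriv gen_c f + mag_mult gen_a (deriv gen_c f)"
| "twist_step gen_b f = mag_mult gen_a (deriv gen_b f)"
| "twist_step gen_c f = mag_mult gen_a (mag_mult gen_a (deriv gen_c f))"
| "twist_step gen_t f = deriv gen_t f"

text \<open>Solving the equations of \<open>twist_step\<close> for the derivatives of the original series gives the
  inverse substitution.\<close>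

fun untwist_step :: "gersten_gen \<Rightarrow> gersten_gen series \<Rightarrow> gersten_gen series" where
  "untwist_step gen_a f = deriv gen_a f - mag_div gen_a (deriv gen_b f)
     - mag_div gen_a (mag_div gen_a (deriv gen_c f)) - mag_div gen_a (deriv gen_c f)"
| "untwist_step gen_b f = mag_div gen_a (deriv gen_b f)"
| "untwist_step gen_c f = mag_div gen_a (mag_div gen_a (deriv gen_c f))"
| "untwist_step gen_t f = deriv gen_t f"

definition twist :: "gersten_gen series \<Rightarrow> gersten_gen series" where
  "twist f = (\<lambda>s. unfold_series twist_step s f)"

definition untwist :: "gersten_gen series \<Rightarrow> gersten_gen series" where
  "untwist f = (\<lambda>s. unfold_series untwist_step s f)"

lemma twist_Nil [simp]: "twist f [] = f []" "untwist f [] = f []"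
  by (simp_all add: twist_def untwist_def)

lemma deriv_twist [simp]:
  "deriv y (twist f) = twist (twist_step y f)"
  "deriv y (untwist f) = untwist (untwist_step y f)"
  by (simp_all add: deriv_def twist_def untwist_def)

lemma unfold_series_add:
  assumes "\<And>y f g. E y (f + g) = E y f + E y g"
  shows "unfold_series E s (f + g) = unfold_series E s f + unfold_series E s g"
  by (induction s arbitrary: f g) (simp_all add: assms)

lemma twist_step_add: "twist_step y (f + g) = twist_step y f + twist_step y g"
  by (cases y) (simp_all add: mag_mult_add)

lemma untwist_step_add: "untwist_step y (f + g) = untwist_step y f + untwist_step y g"
  by (cases y) (simp_all add: mag_div_add)

lemma twist_add: "twist (f + g) = twist f + twist g"
  unfolding twist_def by (rule ext) (simp add: unfold_series_add twist_step_add)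

lemma untwist_add: "untwist (f + g) = untwist f + untwist g"
  unfolding untwist_def by (rule ext) (simp add: unfold_series_add untwist_step_add)

lemma mag_div_0 [simp]: "mag_div x 0 = 0"
  using mag_div_add[of x 0 0] by simp

lemma mag_mult_0 [simp]: "mag_mult x 0 = 0"
  using mag_mult_add[of x 0 0] by simp

lemma twist_0 [simp]: "twist 0 = 0" "untwist 0 = 0"
  using twist_add[of 0 0] untwist_add[of 0 0] by simp_all

text \<open>Together with its analogues for \<open>b\<close> and \<open>c\<close> below, this says that \<open>twist\<close> and the multiplications
  satisfy the defining relations of the Gersten group.\<close>

lemma twist_mag_mult_a: "twist (mag_mult gen_a f) = mag_mult gen_a (twist f)"
proof (rule series_eqI)
  fix y
  have "twist_step y (mag_mult gen_a f) = twist_step y f + (if gen_a = y then f else 0)"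
    by (cases y) (auto simp: algebra_simps)
  then show "deriv y (twist (mag_mult gen_a f)) = deriv y (mag_mult gen_a (twist f))"
    by (auto simp: twist_add)
qed simp

lemma untwist_mag_mult_a: "untwist (mag_mult gen_a f) = mag_mult gen_a (untwist f)"
proof (rule series_eqI)
  fix y
  have "untwist_step y (mag_mult gen_a f) = untwist_step y f + (if gen_a = y then f else 0)"
    by (cases y) (auto simp: algebra_simps)
  then show "deriv y (untwist (mag_mult gen_a f)) = deriv y (mag_mult gen_a (untwist f))"
    by (auto simp: untwist_add)
qed simp

lemma twist_mag_mult_b: "twist (mag_mult gen_b f) = mag_mult gen_b (mag_mult gen_a (twist f))"
proof -
  have "twist (mag_mult gen_b f) = mag_mult gen_b (twist (mag_mult gen_a f))"
  proof (rule series_eqI)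
    fix y
    have "twist_step y (mag_mult gen_b f)
        = twist_step y (mag_mult gen_a f) + (if gen_b = y then mag_mult gen_a f else 0)"
      by (cases y) (auto simp: algebra_simps mag_mult_add)
    then show "deriv y (twist (mag_mult gen_b f)) = deriv y (mag_mult gen_b (twist (mag_mult gen_a f)))"
      by (auto simp: twist_add)
  qed simp
  then show ?thesis by (simp add: twist_mag_mult_a)
qed

lemma twist_mag_mult_c:
  "twist (mag_mult gen_c f) = mag_mult gen_c (mag_mult gen_a (mag_mult gen_a (twist f)))"
proof -
  let ?f = "mag_mult gen_a (mag_mult gen_a f)"
  have "twist (mag_mult gen_c f) = mag_mult gen_c (twist ?f)"
  proof (rule series_eqI)
    fix y
    have "twist_step y (mag_mult gen_c f) = twist_step y ?f + (if gen_c = y then ?f else 0)"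
      by (cases y) (auto simp: algebra_simps mag_mult_add)
    then show "deriv y (twist (mag_mult gen_c f)) = deriv y (mag_mult gen_c (twist ?f))"
      by (auto simp: twist_add)
  qed simp
  then show ?thesis by (simp add: twist_mag_mult_a)
qed

lemma twist_untwist [simp]: "twist (untwist f) = f"
proof
  have "twist_step y (untwist f) = untwist (deriv y f)" for y f
    by (cases y) (simp_all flip: untwist_mag_mult_a untwist_add)
  then show "twist (untwist f) s = f s" for s
    by (induction s arbitrary: f) (simp_all add: twist_def deriv_def)
qed

lemma twist_mag_div_a: "twist (mag_div gen_a f) = mag_div gen_a (twist f)"
  by (metis mag_div_mult mag_mult_div twist_mag_mult_a)

lemma untwist_twist [simp]: "untwist (twist f) = f"
proof
  have "untwist_step y (twist f) = twist (deriv y f)" for y f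
    by (cases y) (simp_all add: twist_add flip: twist_mag_div_a)
  then show "untwist (twist f) s = f s" for s
    by (induction s arbitrary: f) (simp_all add: untwist_def deriv_def)
qed

lemma BijGroup_UNIV:
  "f \<in> carrier (BijGroup UNIV) \<longleftrightarrow> bij f"
  "bij f \<Longrightarrow> bij g \<Longrightarrow> f \<otimes>\<^bsub>BijGroup UNIV\<^esub> g = f \<circ> g"
  "\<one>\<^bsub>BijGroup UNIV\<^esub> = id"
  by (auto simp: BijGroup_def Bij_def compose_def fun_eq_iff)

lemma bij_mag_mult: "bij (mag_mult x)"
  by (rule o_bij[of "mag_div x"]; rule ext; simp)

lemma bij_twist: "bij twist"
  by (rule o_bij[of untwist]; rule ext; simp)

definition magnus :: "gersten_gen letter list set \<Rightarrow> gersten_gen series \<Rightarrow> gersten_gen series" where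
  "magnus = (SOME \<phi>. \<phi> \<in> hom gersten_group (BijGroup UNIV) \<and>
     (\<forall>x. \<phi> (gelt x) = (if x = gen_t then twist else mag_mult x)))"

text \<open>By von Dyck's theorem the operators of the generators extend to an action of the group.\<close>

lemma magnus_spec: "magnus \<in> hom gersten_group (BijGroup UNIV)"
    "magnus (gelt x) = (if x = gen_t then twist else mag_mult x)"
proof -
  obtain \<phi> where "\<phi> \<in> hom gersten_group (BijGroup UNIV)"
    "\<And>x. \<phi> (gelt x) = (if x = gen_t then twist else mag_mult x)"
  proof (rule group.gersten_von_dyck[OF group_BijGroup])
    let ?f = "\<lambda>x. if x = gen_t then twist else mag_mult x"
    show "?f x \<in> carrier (BijGroup UNIV)" for x
      by (simp add: BijGroup_UNIV bij_mag_mult bij_twist)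
    show "?f gen_t \<otimes>\<^bsub>BijGroup UNIV\<^esub> ?f gen_a = ?f gen_a \<otimes>\<^bsub>BijGroup UNIV\<^esub> ?f gen_t"
      by (simp add: BijGroup_UNIV bij_mag_mult bij_twist bij_comp comp_def twist_mag_mult_a)
    show "?f gen_t \<otimes>\<^bsub>BijGroup UNIV\<^esub> ?f gen_b
        = ?f gen_b \<otimes>\<^bsub>BijGroup UNIV\<^esub> ?f gen_a \<otimes>\<^bsub>BijGroup UNIV\<^esub> ?f gen_t"
      by (simp add: BijGroup_UNIV bij_mag_mult bij_twist bij_comp) (simp add: comp_def twist_mag_mult_b)
    show "?f gen_t \<otimes>\<^bsub>BijGroup UNIV\<^esub> ?f gen_c
        = ?f gen_c \<otimes>\<^bsub>BijGroup UNIV\<^esub> ?f gen_a \<otimes>\<^bsub>BijGroup UNIV\<^esub> ?f gen_a \<otimes>\<^bsub>BijGroup UNIV\<^esub> ?f gen_t"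
      by (simp add: BijGroup_UNIV bij_mag_mult bij_twist bij_comp) (simp add: comp_def twist_mag_mult_c)
  qed (rule that)
  then have "\<exists>\<phi>. \<phi> \<in> hom gersten_group (BijGroup UNIV) \<and>
     (\<forall>x. \<phi> (gelt x) = (if x = gen_t then twist else mag_mult x))" by blast
  from someI_ex[OF this] show "magnus \<in> hom gersten_group (BijGroup UNIV)"
    "magnus (gelt x) = (if x = gen_t then twist else mag_mult x)"
    unfolding magnus_def by blast+
qed

lemma magnus_mult:
  assumes "x \<in> carrier gersten_group" "y \<in> carrier gersten_group"
  shows "magnus (x \<otimes>\<^bsub>gersten_group\<^esub> y) f = magnus x (magnus y f)"
proof -
  have "bij (magnus x)" "bij (magnus y)"
    using assms hom_in_carrier[OF magnus_spec(1)] by (simp_all flip: BijGroup_UNIV(1))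
  then show ?thesis using hom_mult[OF magnus_spec(1) assms] by (simp add: BijGroup_UNIV)
qed

lemma magnus_one [simp]: "magnus \<one>\<^bsub>gersten_group\<^esub> f = f"
  using hom_one[OF magnus_spec(1) GG.is_group group_BijGroup] by (simp add: BijGroup_UNIV)

lemma magnus_inv [simp]:
  assumes "x \<in> carrier gersten_group"
  shows "magnus x (magnus (inv\<^bsub>gersten_group\<^esub> x) f) = f" "magnus (inv\<^bsub>gersten_group\<^esub> x) (magnus x f) = f"
  using assms by (simp_all flip: magnus_mult)

lemma magnus_inv_gelt:
  "magnus (inv\<^bsub>gersten_group\<^esub> (gelt x)) = (if x = gen_t then untwist else mag_div x)"
proof
  fix f
  have "f = magnus (gelt x) ((if x = gen_t then untwist else mag_div x) f)"
    by (simp add: magnus_spec)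
  then show "magnus (inv\<^bsub>gersten_group\<^esub> (gelt x)) f = (if x = gen_t then untwist else mag_div x) f"
    using magnus_inv(2)[of "gelt x"] gelt_closed by metis
qed

lemma magnus_add:
  assumes "g \<in> carrier gersten_group"
  shows "magnus g (f + h) = magnus g f + magnus g h"
  using assms
  by (induction arbitrary: f h rule: gersten_induct)
    (simp_all add: magnus_mult magnus_spec magnus_inv_gelt twist_add untwist_add mag_mult_add mag_div_add)


section \<open>Finite quotients from truncated series\<close>

text \<open>Congruence modulo \<open>m\<close> and modulo terms of degree greater than \<open>d\<close>. There are only finitely
  many classes, and the group acts on them; this provides the finite quotients.\<close>

definition trunc_cong :: "nat \<Rightarrow> int \<Rightarrow> 'x series \<Rightarrow> 'x series \<Rightarrow> bool" where
  "trunc_cong d m f g \<longleftrightarrow> (\<forall>s. length s \<le> d \<longrightarrow> m dvd f s - g s)"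

lemma trunc_cong_refl [simp]: "trunc_cong d m f f"
  by (simp add: trunc_cong_def)

lemma trunc_cong_sym: "trunc_cong d m f g \<Longrightarrow> trunc_cong d m g f"
  by (simp add: trunc_cong_def dvd_diff_commute)

lemma trunc_cong_trans: "trunc_cong d m f g \<Longrightarrow> trunc_cong d m g h \<Longrightarrow> trunc_cong d m f h"
  unfolding trunc_cong_def
proof (intro allI impI)
  fix s :: "'a list"
  assume "\<forall>s. length s \<le> d \<longrightarrow> m dvd f s - g s" "\<forall>s. length s \<le> d \<longrightarrow> m dvd g s - h s" "length s \<le> d"
  then have "m dvd (f s - g s) + (g s - h s)" by (intro dvd_add) auto
  then show "m dvd f s - h s" by simp
qed

lemma trunc_cong_add:
  assumes "trunc_cong d m f g" "trunc_cong d m f' g'"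
  shows "trunc_cong d m (f + f') (g + g')" "trunc_cong d m (f - f') (g - g')"
proof -
  have "m dvd (f s - g s) + (f' s - g' s)" "m dvd (f s - g s) - (f' s - g' s)" if "length s \<le> d" for s
    using that assms by (auto simp: trunc_cong_def intro: dvd_add dvd_diff)
  then show "trunc_cong d m (f + f') (g + g')" "trunc_cong d m (f - f') (g - g')"
    by (simp_all add: trunc_cong_def algebra_simps)
qed

lemma trunc_cong_deriv: "trunc_cong (Suc d) m f g \<Longrightarrow> trunc_cong d m (deriv y f) (deriv y g)"
  by (simp add: trunc_cong_def deriv_def)

lemma trunc_cong_mag_mult:
  assumes "trunc_cong d m f g" shows "trunc_cong d m (mag_mult x f) (mag_mult x g)"
  unfolding trunc_cong_def
proof (intro allI impI)
  fix s :: "'a list" assume "length s \<le> d"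
  then show "m dvd mag_mult x f s - mag_mult x g s"
    using assms dvd_add[of m "f s - g s" "f (tl s) - g (tl s)"]
    by (cases s) (auto simp: trunc_cong_def mag_mult_def algebra_simps)
qed

lemma trunc_cong_mag_div:
  assumes "trunc_cong d m f g" shows "trunc_cong d m (mag_div x f) (mag_div x g)"
  unfolding trunc_cong_def
proof (intro allI impI)
  fix s :: "'a list" assume "length s \<le> d"
  then show "m dvd mag_div x f s - mag_div x g s"
  proof (induction s)
    case (Cons y s)
    then show ?case
      using assms dvd_diff[of m "f (y # s) - g (y # s)" "mag_div x f s - mag_div x g s"]
      by (auto simp: trunc_cong_def algebra_simps)
  qed (use assms in \<open>simp add: trunc_cong_def\<close>)
qed

lemma trunc_cong_unfold_series:
  assumes E: "\<And>y d f g. trunc_cong (Suc d) m f g \<Longrightarrow> trunc_cong d m (E y f) (E y g)"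
    and "trunc_cong d m f g"
  shows "trunc_cong d m (\<lambda>s. unfold_series E s f) (\<lambda>s. unfold_series E s g)"
proof -
  have "m dvd unfold_series E s f - unfold_series E s g"
    if "trunc_cong d m f g" "length s \<le> d" for s d f g
    using that
  proof (induction s arbitrary: d f g)
    case (Cons y s)
    then obtain d' where "d = Suc d'" by (cases d) auto
    then show ?case using Cons E[of d' f g y] by auto
  qed (simp add: trunc_cong_def)
  then show ?thesis using assms(2) by (simp add: trunc_cong_def[of d m "\<lambda>s. unfold_series E s f"])
qed

lemma trunc_cong_twist:
  assumes "trunc_cong d m f g" shows "trunc_cong d m (twist f) (twist g)"
  unfolding twist_def
proof (rule trunc_cong_unfold_series[OF _ assms])
  fix y d and f g :: "gersten_gen series" assume "trunc_cong (Suc d) m f g"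
  then show "trunc_cong d m (twist_step y f) (twist_step y g)"
    by (cases y) (simp_all add: trunc_cong_add trunc_cong_deriv trunc_cong_mag_mult)
qed

lemma trunc_cong_untwist:
  assumes "trunc_cong d m f g" shows "trunc_cong d m (untwist f) (untwist g)"
  unfolding untwist_def
proof (rule trunc_cong_unfold_series[OF _ assms])
  fix y d and f g :: "gersten_gen series" assume "trunc_cong (Suc d) m f g"
  then show "trunc_cong d m (untwist_step y f) (untwist_step y g)"
    by (cases y) (simp_all add: trunc_cong_add trunc_cong_deriv trunc_cong_mag_div)
qed

lemma trunc_cong_magnus:
  assumes "g \<in> carrier gersten_group" "trunc_cong d m f h"
  shows "trunc_cong d m (magnus g f) (magnus g h)"
  using assms
  by (induction rule: gersten_induct)
    (simp_all add: magnus_mult magnus_spec magnus_inv_gelt trunc_cong_twist trunc_cong_untwist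
      trunc_cong_mag_mult trunc_cong_mag_div)

definition trunc :: "nat \<Rightarrow> int \<Rightarrow> 'x series \<Rightarrow> 'x series" where
  "trunc d m f = (\<lambda>s. if length s \<le> d then f s mod m else 0)"

lemma trunc_eq_iff: "trunc d m f = trunc d m g \<longleftrightarrow> trunc_cong d m f g"
  by (auto simp: trunc_def trunc_cong_def fun_eq_iff mod_eq_dvd_iff)

lemma trunc_cong_trunc: "trunc_cong d m f (trunc d m f)"
  unfolding trunc_eq_iff[symmetric] by (auto simp: trunc_def)

lemma finite_range_trunc:
  assumes "m > 0" shows "finite (range (trunc d m :: gersten_gen series \<Rightarrow> _))"
proof (rule finite_subset)
  let ?A = "{s :: gersten_gen list. length s \<le> d}"
  show "range (trunc d m) \<subseteq> {f. \<forall>s. (s \<in> ?A \<longrightarrow> f s \<in> {0..<m}) \<and> (s \<notin> ?A \<longrightarrow> f s = 0)}"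
    using assms by (auto simp: trunc_def)
  have "finite (UNIV :: gersten_gen set)" unfolding UNIV_gersten_gen by simp
  then have "finite ?A" using finite_lists_length_le[of UNIV d] by simp
  then show "finite {f. \<forall>s. (s \<in> ?A \<longrightarrow> f s \<in> {0..<m}) \<and> (s \<notin> ?A \<longrightarrow> f s = 0)}"
    by (rule finite_set_of_finite_funs) simp
qed

text \<open>The elements that act trivially on series modulo \<open>m\<close> and modulo degrees above \<open>length s\<close> form a
  normal subgroup of finite index, and the coefficient at \<open>s\<close> of \<open>magnus g f\<close> modulo \<open>m\<close> depends
  only on the coset of \<open>g\<close>.\<close>

lemma profinitely_continuous_coefficient:
  "profinitely_continuous gersten_group (\<lambda>g. magnus g f s)"
  unfolding profinitely_continuous_def
proof (intro allI impI)
  fix m :: int assume m: "m > 0"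
  define d where "d = length s"
  define N where "N = {g \<in> carrier gersten_group. \<forall>f. trunc_cong d m (magnus g f) f}"
  have sub: "subgroup N gersten_group"
  proof (rule GG.subgroupI)
    show "N \<subseteq> carrier gersten_group" "N \<noteq> {}"
      by (auto simp: N_def intro!: exI[of _ "\<one>\<^bsub>gersten_group\<^esub>"])
  next
    fix g assume g: "g \<in> N"
    have "trunc_cong d m (magnus (inv\<^bsub>gersten_group\<^esub> g) f) f" for f
    proof -
      have "trunc_cong d m (magnus g (magnus (inv\<^bsub>gersten_group\<^esub> g) f)) (magnus (inv\<^bsub>gersten_group\<^esub> g) f)"
        using g by (simp only: N_def mem_Collect_eq)
      then show ?thesis using g by (simp add: N_def trunc_cong_sym)
    qed
    then show "inv\<^bsub>gersten_group\<^esub> g \<in> N" using g by (simp add: N_def)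
  next
    fix g h assume "g \<in> N" "h \<in> N"
    then show "g \<otimes>\<^bsub>gersten_group\<^esub> h \<in> N"
      by (auto simp: N_def magnus_mult intro: trunc_cong_trans)
  qed
  have normal: "N \<lhd> gersten_group"
  proof (rule GG.normal_invI[OF sub])
    fix g h assume gh: "g \<in> carrier gersten_group" "h \<in> N"
    have "trunc_cong d m (magnus g (magnus h (magnus (inv\<^bsub>gersten_group\<^esub> g) f)))
       (magnus g (magnus (inv\<^bsub>gersten_group\<^esub> g) f))" for f
      using gh by (intro trunc_cong_magnus) (auto simp: N_def)
    then show "g \<otimes>\<^bsub>gersten_group\<^esub> h \<otimes>\<^bsub>gersten_group\<^esub> inv\<^bsub>gersten_group\<^esub> g \<in> N"
      using gh by (simp add: N_def magnus_mult)
  qed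
  let ?S = "range (trunc d m :: gersten_gen series \<Rightarrow> _)"
  let ?F = "\<lambda>g. \<lambda>f\<in>?S. trunc d m (magnus g f)"
  have "finite (rcosets\<^bsub>gersten_group\<^esub> N)"
  proof (rule GG.finite_rcosetsI[OF sub, where F = ?F])
    have "?F ` carrier gersten_group \<subseteq> ?S \<rightarrow>\<^sub>E ?S" by auto
    then show "finite (?F ` carrier gersten_group)"
      by (rule finite_subset) (intro finite_PiE finite_range_trunc m)
  next
    fix g h assume gh: "g \<in> carrier gersten_group" "h \<in> carrier gersten_group" and eq: "?F g = ?F h"
    have "trunc_cong d m (magnus g f) (magnus h f)" for f
    proof -
      have "trunc d m (magnus g (trunc d m f)) = trunc d m (magnus h (trunc d m f))"
        using fun_cong[OF eq, of "trunc d m f"] by simp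
      then have "trunc_cong d m (magnus g (trunc d m f)) (magnus h (trunc d m f))"
        by (simp add: trunc_eq_iff)
      then show ?thesis
        using trunc_cong_magnus[OF _ trunc_cong_trunc] gh
        by (meson trunc_cong_sym trunc_cong_trans)
    qed
    from this[of "magnus (inv\<^bsub>gersten_group\<^esub> h) _"]
    show "g \<otimes>\<^bsub>gersten_group\<^esub> inv\<^bsub>gersten_group\<^esub> h \<in> N"
      using gh by (simp add: N_def magnus_mult)
  qed
  moreover have "m dvd magnus x f s - magnus y f s"
    if "x \<in> carrier gersten_group" "y \<in> carrier gersten_group"
      "x \<otimes>\<^bsub>gersten_group\<^esub> inv\<^bsub>gersten_group\<^esub> y \<in> N" for x y
  proof -
    have "trunc_cong d m (magnus (x \<otimes>\<^bsub>gersten_group\<^esub> inv\<^bsub>gersten_group\<^esub> y) (magnus y f)) (magnus y f)"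
      using that(3) by (simp add: N_def)
    then show ?thesis using that(1,2) by (simp add: magnus_mult trunc_cong_def d_def)
  qed
  ultimately show "\<exists>N. N \<lhd> gersten_group \<and> finite (rcosets\<^bsub>gersten_group\<^esub> N) \<and>
      (\<forall>x\<in>carrier gersten_group. \<forall>y\<in>carrier gersten_group.
        x \<otimes>\<^bsub>gersten_group\<^esub> inv\<^bsub>gersten_group\<^esub> y \<in> N \<longrightarrow> m dvd magnus x f s - magnus y f s)"
    using normal by blast
qed

lemma (in group) profinitely_continuous_hom:
  assumes c: "c \<in> hom G integer_group"
  shows "profinitely_continuous G c"
  unfolding profinitely_continuous_def
proof (intro allI impI)
  interpret c: group_hom G integer_group c
    using c by (simp add: group_hom_def group_hom_axioms_def is_group)
  fix m :: int assume m: "m > 0"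
  define N where "N = {g \<in> carrier G. m dvd c g}"
  have sub: "subgroup N G"
    by (rule subgroupI) (auto simp: N_def intro!: exI[of _ \<one>])
  have normal: "N \<lhd> G"
    by (rule normal_invI[OF sub]) (auto simp: N_def)
  have iff: "x \<otimes> inv y \<in> N \<longleftrightarrow> m dvd c x - c y" if "x \<in> carrier G" "y \<in> carrier G" for x y
    using that by (simp add: N_def)
  have "finite (rcosets N)"
  proof (rule finite_rcosetsI[OF sub, where F = "\<lambda>x. c x mod m"])
    have "(\<lambda>x. c x mod m) ` carrier G \<subseteq> {0..<m}" using m by auto
    then show "finite ((\<lambda>x. c x mod m) ` carrier G)" by (rule finite_subset) simp
  qed (simp add: iff mod_eq_dvd_iff)
  with normal iff show "\<exists>N. N \<lhd> G \<and> finite (rcosets N) \<and>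
      (\<forall>x\<in>carrier G. \<forall>y\<in>carrier G. x \<otimes> inv y \<in> N \<longrightarrow> m dvd c x - c y)"
    by blast
qed


section \<open>The free normal subgroup\<close>

definition free_part :: "gersten_gen letter list set set" where
  "free_part = generate gersten_group (gelt ` {gen_a, gen_b, gen_c})"

lemma subgroup_free_part: "subgroup free_part gersten_group"
  unfolding free_part_def by (rule GG.generate_is_subgroup) auto

lemma gelt_free_part: "x \<noteq> gen_t \<Longrightarrow> gelt x \<in> free_part"
  unfolding free_part_def by (rule generate.incl) (cases x; simp)

lemma free_part_induct [consumes 1, case_names one gen inv_gen mult]:
  assumes "g \<in> free_part"
    and "P \<one>\<^bsub>gersten_group\<^esub>"
    and "\<And>x. x \<noteq> gen_t \<Longrightarrow> P (gelt x)"
    and "\<And>x. x \<noteq> gen_t \<Longrightarrow> P (inv\<^bsub>gersten_group\<^esub> (gelt x))"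
    and "\<And>g h. g \<in> free_part \<Longrightarrow> P g \<Longrightarrow> h \<in> free_part \<Longrightarrow> P h \<Longrightarrow> P (g \<otimes>\<^bsub>gersten_group\<^esub> h)"
  shows "P g"
  using assms(1) unfolding free_part_def
  by induction (use assms(2-) in \<open>auto simp: free_part_def\<close>)

lemma free_part_closed [simp]: "g \<in> free_part \<Longrightarrow> g \<in> carrier gersten_group"
  using subgroup.mem_carrier[OF subgroup_free_part] .

lemma (in group) conj_generate:
  assumes "A \<subseteq> carrier G" "x \<in> carrier G" "\<And>h. h \<in> A \<Longrightarrow> x \<otimes> h \<otimes> inv x \<in> generate G A"
    and "u \<in> generate G A"
  shows "x \<otimes> u \<otimes> inv x \<in> generate G A"
  using assms(4)
proof induction
  case one
  then show ?case using assms by (simp add: generate.one)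
next
  case (incl h)
  then show ?case by (rule assms(3))
next
  case (inv h)
  then have "inv (x \<otimes> h \<otimes> inv x) \<in> generate G A"
    using generate_m_inv_closed[OF assms(1) assms(3)] by simp
  moreover have "h \<in> carrier G" using inv assms by auto
  ultimately show ?case using assms(2) by (simp add: inv_mult_group m_assoc)
next
  case (eng g h)
  then have "g \<in> carrier G" "h \<in> carrier G" using generate_in_carrier[OF assms(1)] by auto
  then have "x \<otimes> (g \<otimes> h) \<otimes> inv x = (x \<otimes> g \<otimes> inv x) \<otimes> (x \<otimes> h \<otimes> inv x)"
    using assms(2) by (simp add: m_assoc inv_cancel_left)
  then show ?case using eng generate.eng by metis
qed

text \<open>It suffices to conjugate generators. For the inverse of \<open>t\<close>, the relations give
  \<open>t\<inverse> b t = b a\<inverse>\<close> and \<open>t\<inverse> c t = c a\<^bsup>-2\<^esup>\<close>.\<close>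

lemma conj_free_part:
  assumes "u \<in> free_part"
  shows "gelt gen_t \<otimes>\<^bsub>gersten_group\<^esub> u \<otimes>\<^bsub>gersten_group\<^esub> inv\<^bsub>gersten_group\<^esub> (gelt gen_t) \<in> free_part"
    and "inv\<^bsub>gersten_group\<^esub> (gelt gen_t) \<otimes>\<^bsub>gersten_group\<^esub> u \<otimes>\<^bsub>gersten_group\<^esub> gelt gen_t \<in> free_part"
proof -
  let ?a = "gelt gen_a" and ?b = "gelt gen_b" and ?c = "gelt gen_c" and ?t = "gelt gen_t"
  note closed = subgroup.m_closed[OF subgroup_free_part] subgroup.m_inv_closed[OF subgroup_free_part]
    gelt_free_part
  have *: "x \<otimes>\<^bsub>gersten_group\<^esub> u \<otimes>\<^bsub>gersten_group\<^esub> inv\<^bsub>gersten_group\<^esub> x \<in> free_part"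
    if "x \<in> carrier gersten_group"
      "\<And>y. y \<in> {?a, ?b, ?c} \<Longrightarrow> x \<otimes>\<^bsub>gersten_group\<^esub> y \<otimes>\<^bsub>gersten_group\<^esub> inv\<^bsub>gersten_group\<^esub> x \<in> free_part" for x
    using GG.conj_generate[of "gelt ` {gen_a, gen_b, gen_c}" x u] that assms
    by (auto simp: free_part_def)
  have t: "?t \<otimes>\<^bsub>gersten_group\<^esub> ?a \<otimes>\<^bsub>gersten_group\<^esub> inv\<^bsub>gersten_group\<^esub> ?t = ?a"
    "?t \<otimes>\<^bsub>gersten_group\<^esub> ?b \<otimes>\<^bsub>gersten_group\<^esub> inv\<^bsub>gersten_group\<^esub> ?t = ?b \<otimes>\<^bsub>gersten_group\<^esub> ?a"
    "?t \<otimes>\<^bsub>gersten_group\<^esub> ?c \<otimes>\<^bsub>gersten_group\<^esub> inv\<^bsub>gersten_group\<^esub> ?t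
      = ?c \<otimes>\<^bsub>gersten_group\<^esub> ?a \<otimes>\<^bsub>gersten_group\<^esub> ?a"
    by (simp_all add: gersten_relations) (simp_all add: GG.m_assoc)
  show "?t \<otimes>\<^bsub>gersten_group\<^esub> u \<otimes>\<^bsub>gersten_group\<^esub> inv\<^bsub>gersten_group\<^esub> ?t \<in> free_part"
    by (rule *) (auto simp: t closed)
  have t': "inv\<^bsub>gersten_group\<^esub> ?t \<otimes>\<^bsub>gersten_group\<^esub> y \<otimes>\<^bsub>gersten_group\<^esub> ?t \<otimes>\<^bsub>gersten_group\<^esub> z = y"
    if "?t \<otimes>\<^bsub>gersten_group\<^esub> y = y \<otimes>\<^bsub>gersten_group\<^esub> (?t \<otimes>\<^bsub>gersten_group\<^esub> z)"
      "y \<in> carrier gersten_group" "z \<in> carrier gersten_group" for y z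
    using GG.inv_cancel_left(1)[of ?t y] that by (simp add: GG.m_assoc)
  have ta: "?t \<otimes>\<^bsub>gersten_group\<^esub> (?a \<otimes>\<^bsub>gersten_group\<^esub> z) = ?a \<otimes>\<^bsub>gersten_group\<^esub> (?t \<otimes>\<^bsub>gersten_group\<^esub> z)"
    if "z \<in> carrier gersten_group" for z
    using that gersten_relations(1) by (simp flip: GG.m_assoc)
  have "inv\<^bsub>gersten_group\<^esub> ?t \<otimes>\<^bsub>gersten_group\<^esub> ?a \<otimes>\<^bsub>gersten_group\<^esub> ?t = ?a"
    using t'[of ?a "\<one>\<^bsub>gersten_group\<^esub>"] gersten_relations(1) by simp
  moreover have "inv\<^bsub>gersten_group\<^esub> ?t \<otimes>\<^bsub>gersten_group\<^esub> ?b \<otimes>\<^bsub>gersten_group\<^esub> ?t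
      = ?b \<otimes>\<^bsub>gersten_group\<^esub> inv\<^bsub>gersten_group\<^esub> ?a"
    using t'[of ?b ?a] gersten_relations(1,2) by (simp add: GG.m_assoc GG.inv_solve_right)
  moreover have "inv\<^bsub>gersten_group\<^esub> ?t \<otimes>\<^bsub>gersten_group\<^esub> ?c \<otimes>\<^bsub>gersten_group\<^esub> ?t
      = ?c \<otimes>\<^bsub>gersten_group\<^esub> inv\<^bsub>gersten_group\<^esub> (?a \<otimes>\<^bsub>gersten_group\<^esub> ?a)"
    using t'[of ?c "?a \<otimes>\<^bsub>gersten_group\<^esub> ?a"] gersten_relations(1,3) ta
    by (simp add: GG.m_assoc GG.inv_solve_right del: GG.inv_mult_group)
  ultimately have "inv\<^bsub>gersten_group\<^esub> ?t \<otimes>\<^bsub>gersten_group\<^esub> y \<otimes>\<^bsub>gersten_group\<^esub> ?t \<in> free_part"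
    if "y \<in> {?a, ?b, ?c}" for y
    using that by (auto simp: closed)
  then show "inv\<^bsub>gersten_group\<^esub> ?t \<otimes>\<^bsub>gersten_group\<^esub> u \<otimes>\<^bsub>gersten_group\<^esub> ?t \<in> free_part"
    using *[of "inv\<^bsub>gersten_group\<^esub> ?t"] by simp
qed

lemma free_by_cyclic_decomposition:
  assumes "g \<in> carrier gersten_group"
  obtains u j where "u \<in> free_part" "g = u \<otimes>\<^bsub>gersten_group\<^esub> gelt gen_t [^]\<^bsub>gersten_group\<^esub> (j::int)"
proof -
  let ?t = "gelt gen_t"
  note closed = subgroup.m_closed[OF subgroup_free_part] subgroup.m_inv_closed[OF subgroup_free_part]
    gelt_free_part
  have "\<exists>u\<in>free_part. \<exists>j::int. g = u \<otimes>\<^bsub>gersten_group\<^esub> ?t [^]\<^bsub>gersten_group\<^esub> j"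
    using assms
  proof (induction rule: gersten_induct)
    case one
    show ?case
      using subgroup.one_closed[OF subgroup_free_part] by (intro bexI[of _ "\<one>\<^bsub>gersten_group\<^esub>"] exI[of _ 0]) simp_all
  next
    case (gen x g)
    then obtain u and j :: int where u: "u \<in> free_part" "g = u \<otimes>\<^bsub>gersten_group\<^esub> ?t [^]\<^bsub>gersten_group\<^esub> j"
      by blast
    show ?case
    proof (cases "x = gen_t")
      case True
      have "?t \<otimes>\<^bsub>gersten_group\<^esub> g
          = (?t \<otimes>\<^bsub>gersten_group\<^esub> u \<otimes>\<^bsub>gersten_group\<^esub> inv\<^bsub>gersten_group\<^esub> ?t) \<otimes>\<^bsub>gersten_group\<^esub> ?t [^]\<^bsub>gersten_group\<^esub> (1 + j)"
        using u by (simp add: GG.int_pow_mult GG.m_assoc GG.inv_cancel_left)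
      then show ?thesis using conj_free_part(1)[OF u(1)] True by blast
    next
      case False
      have "gelt x \<otimes>\<^bsub>gersten_group\<^esub> g = (gelt x \<otimes>\<^bsub>gersten_group\<^esub> u) \<otimes>\<^bsub>gersten_group\<^esub> ?t [^]\<^bsub>gersten_group\<^esub> j"
        using u by (simp add: GG.m_assoc)
      then show ?thesis using closed(1)[OF closed(3)[OF False] u(1)] by blast
    qed
  next
    case (inv_gen x g)
    then obtain u and j :: int where u: "u \<in> free_part" "g = u \<otimes>\<^bsub>gersten_group\<^esub> ?t [^]\<^bsub>gersten_group\<^esub> j"
      by blast
    show ?case
    proof (cases "x = gen_t")
      case True
      have "?t \<otimes>\<^bsub>gersten_group\<^esub> ?t [^]\<^bsub>gersten_group\<^esub> (j - 1) = ?t [^]\<^bsub>gersten_group\<^esub> j"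
        using GG.int_pow_mult[of ?t 1 "j - 1"] by simp
      then have "inv\<^bsub>gersten_group\<^esub> ?t \<otimes>\<^bsub>gersten_group\<^esub> g
          = (inv\<^bsub>gersten_group\<^esub> ?t \<otimes>\<^bsub>gersten_group\<^esub> u \<otimes>\<^bsub>gersten_group\<^esub> ?t) \<otimes>\<^bsub>gersten_group\<^esub> ?t [^]\<^bsub>gersten_group\<^esub> (j - 1)"
        using u by (simp add: GG.m_assoc)
      then show ?thesis using conj_free_part(2)[OF u(1)] True by blast
    next
      case False
      have "inv\<^bsub>gersten_group\<^esub> (gelt x) \<otimes>\<^bsub>gersten_group\<^esub> g
          = (inv\<^bsub>gersten_group\<^esub> (gelt x) \<otimes>\<^bsub>gersten_group\<^esub> u) \<otimes>\<^bsub>gersten_group\<^esub> ?t [^]\<^bsub>gersten_group\<^esub> j"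
        using u by (simp add: GG.m_assoc)
      then show ?thesis using closed(1)[OF closed(2)[OF closed(3)[OF False]] u(1)] by blast
    qed
  qed
  then show thesis using that by blast
qed

lemma t_exponent:
  obtains e where "e \<in> hom gersten_group integer_group" "e (gelt gen_t) = 1"
    "\<And>x. x \<noteq> gen_t \<Longrightarrow> e (gelt x) = 0"
proof (rule group.gersten_von_dyck[OF group_integer_group])
  let ?f = "\<lambda>x. if x = gen_t then 1 else 0 :: int"
  show "?f gen_t \<otimes>\<^bsub>integer_group\<^esub> ?f gen_a = ?f gen_a \<otimes>\<^bsub>integer_group\<^esub> ?f gen_t"
    "?f gen_t \<otimes>\<^bsub>integer_group\<^esub> ?f gen_b = ?f gen_b \<otimes>\<^bsub>integer_group\<^esub> ?f gen_a \<otimes>\<^bsub>integer_group\<^esub> ?f gen_t"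
    "?f gen_t \<otimes>\<^bsub>integer_group\<^esub> ?f gen_c
      = ?f gen_c \<otimes>\<^bsub>integer_group\<^esub> ?f gen_a \<otimes>\<^bsub>integer_group\<^esub> ?f gen_a \<otimes>\<^bsub>integer_group\<^esub> ?f gen_t"
    by simp_all
  fix e assume "e \<in> hom gersten_group integer_group" "\<And>x. e (gelt x) = ?f x"
  then show thesis by (intro that[of e]) simp_all
qed simp

text \<open>A list of blocks \<open>(x\<^sub>1, e\<^sub>1), \<dots>, (x\<^sub>r, e\<^sub>r)\<close> stands for \<open>x\<^sub>1\<^bsup>e\<^sub>1\<^esup> \<cdots> x\<^sub>r\<^bsup>e\<^sub>r\<^esup>\<close>. Reduced lists, the usual
  normal forms in a free group, are the ones whose leading Magnus coefficients can be read off.\<close>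

primrec block_prod :: "(gersten_gen \<times> int) list \<Rightarrow> gersten_gen letter list set" where
  "block_prod [] = \<one>\<^bsub>gersten_group\<^esub>"
| "block_prod (p # bl) = gelt (fst p) [^]\<^bsub>gersten_group\<^esub> snd p \<otimes>\<^bsub>gersten_group\<^esub> block_prod bl"

definition reduced_blocks :: "(gersten_gen \<times> int) list \<Rightarrow> bool" where
  "reduced_blocks bl \<longleftrightarrow> distinct_adj (map fst bl) \<and> (\<forall>p\<in>set bl. fst p \<noteq> gen_t \<and> snd p \<noteq> 0)"

lemma block_prod_closed [simp]: "block_prod bl \<in> carrier gersten_group"
  by (induction bl) auto

lemma reduced_blocks_pow_mult:
  assumes "x \<noteq> gen_t" "reduced_blocks bl"
  obtains bl' where "reduced_blocks bl'"
    "gelt x [^]\<^bsub>gersten_group\<^esub> (e::int) \<otimes>\<^bsub>gersten_group\<^esub> block_prod bl = block_prod bl'"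
proof (cases "e = 0")
  case True
  then show ?thesis using that[OF assms(2)] by simp
next
  case e: False
  show ?thesis
  proof (cases "bl \<noteq> [] \<and> fst (hd bl) = x")
    case True
    then obtain e' bl' where bl: "bl = (x, e') # bl'" by (cases bl) auto
    have "gelt x [^]\<^bsub>gersten_group\<^esub> e \<otimes>\<^bsub>gersten_group\<^esub> block_prod bl
        = gelt x [^]\<^bsub>gersten_group\<^esub> (e + e') \<otimes>\<^bsub>gersten_group\<^esub> block_prod bl'"
      by (simp add: bl GG.int_pow_mult GG.m_assoc)
    moreover have "reduced_blocks bl'" using assms(2) bl
      by (auto simp: reduced_blocks_def distinct_adj_Cons)
    moreover have "reduced_blocks ((x, e + e') # bl')" if "e + e' \<noteq> 0"
      using assms bl that by (auto simp: reduced_blocks_def distinct_adj_Cons)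
    ultimately show ?thesis
      using that[of bl'] that[of "(x, e + e') # bl'"] by (cases "e + e' = 0") auto
  next
    case False
    then have "reduced_blocks ((x, e) # bl)"
      using assms e by (cases bl) (auto simp: reduced_blocks_def)
    then show ?thesis using that by fastforce
  qed
qed

lemma free_part_block_prod:
  assumes "u \<in> free_part"
  obtains bl where "reduced_blocks bl" "u = block_prod bl"
proof -
  have prod: "\<exists>bl''. reduced_blocks bl'' \<and> block_prod bl \<otimes>\<^bsub>gersten_group\<^esub> block_prod bl' = block_prod bl''"
    if "\<forall>p\<in>set bl. fst p \<noteq> gen_t" "reduced_blocks bl'" for bl bl'
    using that(1)
  proof (induction bl)
    case (Cons p bl)
    then obtain bl'' where bl'': "reduced_blocks bl''"
      "block_prod bl \<otimes>\<^bsub>gersten_group\<^esub> block_prod bl' = block_prod bl''" by auto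
    obtain bl3 where "reduced_blocks bl3"
      "gelt (fst p) [^]\<^bsub>gersten_group\<^esub> snd p \<otimes>\<^bsub>gersten_group\<^esub> block_prod bl'' = block_prod bl3"
      using reduced_blocks_pow_mult[of "fst p" bl'' "snd p"] Cons.prems bl''(1) by auto
    then show ?case using bl''(2) by (auto simp: GG.m_assoc)
  qed (use that in auto)
  have "\<exists>bl. reduced_blocks bl \<and> u = block_prod bl"
    using assms
  proof (induction rule: free_part_induct)
    case one
    show ?case by (intro exI[of _ "[]"]) (simp add: reduced_blocks_def)
  next
    case (gen x)
    then show ?case by (intro exI[of _ "[(x, 1)]"]) (simp add: reduced_blocks_def)
  next
    case (inv_gen x)
    then show ?case
      by (intro exI[of _ "[(x, - 1)]"]) (simp add: reduced_blocks_def GG.int_pow_neg)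
  next
    case (mult g h)
    then obtain bl bl' where bl: "reduced_blocks bl" "g = block_prod bl" "reduced_blocks bl'" "h = block_prod bl'"
      by blast
    then have "\<forall>p\<in>set bl. fst p \<noteq> gen_t" by (simp add: reduced_blocks_def)
    then show ?case using prod[of bl bl'] bl by simp
  qed
  then show thesis using that by blast
qed


section \<open>Faithfulness of the Magnus module\<close>

definition one_series :: "'x series" where
  "one_series s = (if s = [] then 1 else 0)"

text \<open>The factor \<open>(1 + x)\<^sup>e = 1 + e x + \<dots>\<close> interacts with a monomial only through its initial run of
  \<open>x\<close>. If that run has length at most one, the terms of degree at least two do not contribute, so the
  formula is the same for positive and negative \<open>e\<close>.\<close>

lemma magnus_pow:
  assumes "x \<noteq> gen_t" "s = [] \<or> hd s \<noteq> x"
  shows "magnus (gelt x [^]\<^bsub>gersten_group\<^esub> (e::int)) f s = f s"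
    and "magnus (gelt x [^]\<^bsub>gersten_group\<^esub> e) f (x # s) = f (x # s) + e * f s"
proof -
  have eqs: "mag_mult x h s = h s" "mag_mult x h (x # s) = h (x # s) + h s"
    "mag_div x h s = h s" "mag_div x h (x # s) = h (x # s) - h s" for h
    using assms(2) by (cases s; auto simp: mag_mult_def)+
  have "magnus (gelt x [^]\<^bsub>gersten_group\<^esub> e) f s = f s \<and>
    magnus (gelt x [^]\<^bsub>gersten_group\<^esub> e) f (x # s) = f (x # s) + e * f s"
  proof (induction e rule: int_induct[of _ 0])
    case base
    show ?case by simp
  next
    case (step1 e)
    have "gelt x [^]\<^bsub>gersten_group\<^esub> (e + 1) = gelt x \<otimes>\<^bsub>gersten_group\<^esub> gelt x [^]\<^bsub>gersten_group\<^esub> e"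
      using GG.int_pow_mult[of "gelt x" 1 e] by (simp add: add.commute)
    then show ?case
      using step1 assms(1) by (simp add: magnus_mult magnus_spec eqs algebra_simps)
  next
    case (step2 e)
    have "gelt x [^]\<^bsub>gersten_group\<^esub> (e - 1) = inv\<^bsub>gersten_group\<^esub> (gelt x) \<otimes>\<^bsub>gersten_group\<^esub> gelt x [^]\<^bsub>gersten_group\<^esub> e"
      using GG.int_pow_mult[of "gelt x" "- 1" e] by (simp add: GG.int_pow_neg)
    then show ?case
      using step2 assms(1) by (simp add: magnus_mult magnus_inv_gelt eqs algebra_simps)
  qed
  then show "magnus (gelt x [^]\<^bsub>gersten_group\<^esub> e) f s = f s"
    and "magnus (gelt x [^]\<^bsub>gersten_group\<^esub> e) f (x # s) = f (x # s) + e * f s" by auto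
qed

text \<open>Multiplying out \<open>(1 + x\<^sub>1)\<^bsup>e\<^sub>1\<^esup> \<cdots> (1 + x\<^sub>r)\<^bsup>e\<^sub>r\<^esup>\<close>, a monomial without repeated adjacent letters receives
  at most one letter from each factor. If its length is at least \<open>r\<close>, it must be \<open>x\<^sub>1 \<cdots> x\<^sub>r\<close>, with
  coefficient \<open>e\<^sub>1 \<cdots> e\<^sub>r\<close>. Allowing lengths beyond \<open>r\<close> makes the induction work.\<close>

lemma magnus_block_prod:
  assumes "reduced_blocks bl" "distinct_adj s" "length bl \<le> length s"
  shows "magnus (block_prod bl) one_series s
    = (if s = map fst bl then prod_list (map snd bl) else 0)"
  using assms
proof (induction bl arbitrary: s)
  case Nil
  then show ?case by (simp add: one_series_def)
next
  case (Cons p bl)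
  obtain x e where p: "p = (x, e)" by (cases p)
  obtain y s' where s: "s = y # s'" using Cons.prems(3) by (cases s) auto
  have x: "x \<noteq> gen_t" and bl: "reduced_blocks bl"
    using Cons.prems(1) by (auto simp: p reduced_blocks_def distinct_adj_Cons)
  have s': "distinct_adj s'" "s' = [] \<or> hd s' \<noteq> y" "length bl \<le> length s'"
    using Cons.prems(2,3) by (auto simp: s distinct_adj_Cons)
  have IH: "magnus (block_prod bl) one_series s = 0"
    "magnus (block_prod bl) one_series s' = (if s' = map fst bl then prod_list (map snd bl) else 0)"
    using Cons.IH[OF bl Cons.prems(2)] Cons.IH[OF bl s'(1,3)] Cons.prems(3) by auto
  show ?case
  proof (cases "x = y")
    case True
    then show ?thesis using magnus_pow(2)[OF x, of s'] s'(2) IH by (simp add: p s magnus_mult)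
  next
    case False
    then show ?thesis using magnus_pow(1)[OF x, of s] IH by (simp add: p s magnus_mult)
  qed
qed

lemma magnus_faithful_free_part:
  assumes "u \<in> free_part" "u \<noteq> \<one>\<^bsub>gersten_group\<^esub>"
  obtains s where "s \<noteq> []" "magnus u one_series s \<noteq> 0"
proof -
  obtain bl where bl: "reduced_blocks bl" "u = block_prod bl"
    using free_part_block_prod[OF assms(1)] .
  have "bl \<noteq> []" using bl(2) assms(2) by auto
  moreover have "magnus u one_series (map fst bl) = prod_list (map snd bl)"
    using magnus_block_prod[OF bl(1), of "map fst bl"] bl by (simp add: reduced_blocks_def)
  moreover have "prod_list (map snd bl) \<noteq> 0"
    using bl(1) by (auto simp: reduced_blocks_def prod_list_zero_iff)
  ultimately show thesis using that[of "map fst bl"] by simp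
qed

text \<open>Multiplication by \<open>1 + x\<close> does not change the part of lowest degree.\<close>

lemma magnus_unipotent:
  assumes "u \<in> free_part" "\<And>s. length s < d \<Longrightarrow> f s = 0" "length s \<le> d"
  shows "magnus u f s = f s"
  using assms
proof (induction arbitrary: f s rule: free_part_induct)
  case (gen x)
  then show ?case by (cases s) (auto simp: magnus_spec mag_mult_def)
next
  case (inv_gen x)
  have "mag_div x f s = f s" using inv_gen(3)
  proof (induction s)
    case (Cons y s)
    then show ?case using inv_gen(2)[of s] by auto
  qed simp
  then show ?case using inv_gen(1) by (simp add: magnus_inv_gelt)
next
  case (mult g h)
  have *: "magnus h f s' = f s'" if "length s' \<le> d" for s'
    using mult.IH(2)[of f s'] mult.prems(1) that by blast
  have "magnus g (magnus h f) s = magnus h f s"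
    using mult.IH(1)[of "magnus h f" s] mult.prems * by simp
  then show ?case using mult * by (simp add: magnus_mult)
qed simp

text \<open>If \<open>g = 1 + g\<^sub>d + (higher degrees)\<close>, then \<open>g\<^sup>k = 1 + k g\<^sub>d + (higher degrees)\<close>: on the subgroup \<open>V\<close> of
  elements whose series is \<open>1\<close> below degree \<open>d\<close>, the coefficients of degree \<open>d\<close> are additive.\<close>

lemma leading_coefficient_pow:
  assumes g: "g \<in> free_part" and low: "\<And>s. s \<noteq> [] \<Longrightarrow> length s < d \<Longrightarrow> magnus g one_series s = 0"
    and s: "s \<noteq> []" "length s \<le> d"
  shows "magnus (g [^]\<^bsub>gersten_group\<^esub> (k::int)) one_series s = k * magnus g one_series s"
proof -
  define V where "V = {v \<in> free_part. \<forall>s. s \<noteq> [] \<longrightarrow> length s < d \<longrightarrow> magnus v one_series s = 0}"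
  have N: "magnus v (magnus w one_series) s = magnus v one_series s + (magnus w one_series - one_series) s"
    if "v \<in> free_part" "w \<in> V" "length s \<le> d" for v w s
  proof -
    let ?N = "magnus w one_series - one_series"
    have "magnus w one_series [] = 1"
      using magnus_unipotent[of w 0 one_series "[]"] that(2) by (simp add: V_def one_series_def)
    then have "?N s = 0" if "length s < d" for s
      using that \<open>w \<in> V\<close> by (cases "s = []") (auto simp: V_def one_series_def)
    then have "magnus v ?N s = ?N s" using magnus_unipotent[OF that(1)] that(3) by blast
    moreover have "magnus v (magnus w one_series) = magnus v one_series + magnus v ?N"
      using magnus_add[of v one_series ?N] that(1) by simp
    ultimately show ?thesis by simp
  qed
  have mult: "magnus (v \<otimes>\<^bsub>gersten_group\<^esub> w) one_series s = magnus v one_series s + magnus w one_series s"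
    if "v \<in> V" "w \<in> V" "s \<noteq> []" "length s \<le> d" for v w s
    using N[of v w s] that by (simp add: V_def magnus_mult one_series_def)
  have V: "subgroup V gersten_group"
  proof (rule GG.subgroupI)
    show "V \<subseteq> carrier gersten_group" by (auto simp: V_def)
    have "\<one>\<^bsub>gersten_group\<^esub> \<in> V"
      using subgroup.one_closed[OF subgroup_free_part] by (auto simp: V_def one_series_def)
    then show "V \<noteq> {}" by blast
  next
    fix v assume v: "v \<in> V"
    then have v': "inv\<^bsub>gersten_group\<^esub> v \<in> free_part"
      using subgroup.m_inv_closed[OF subgroup_free_part] by (simp add: V_def)
    moreover have "magnus (inv\<^bsub>gersten_group\<^esub> v) one_series s = 0" if "s \<noteq> []" "length s < d" for s
      using N[OF v' v, of s] that v by (simp add: V_def one_series_def)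
    ultimately show "inv\<^bsub>gersten_group\<^esub> v \<in> V" by (simp add: V_def)
  next
    fix v w assume vw: "v \<in> V" "w \<in> V"
    then have "v \<otimes>\<^bsub>gersten_group\<^esub> w \<in> free_part"
      using subgroup.m_closed[OF subgroup_free_part] by (simp add: V_def)
    then show "v \<otimes>\<^bsub>gersten_group\<^esub> w \<in> V" using mult[OF vw] vw by (simp add: V_def)
  qed
  have gV: "g \<in> V" using g low by (simp add: V_def)
  have step: "magnus (g [^]\<^bsub>gersten_group\<^esub> (i + 1)) one_series s
      = magnus g one_series s + magnus (g [^]\<^bsub>gersten_group\<^esub> i) one_series s" for i :: int
    using mult[OF gV GG.subgroup_int_pow_closed[OF V gV] s, of i] g
      GG.int_pow_mult[of g 1 i] by (simp add: add.commute)
  show ?thesis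
  proof (induction k rule: int_induct[of _ 0])
    case base
    then show ?case using s by (simp add: one_series_def)
  next
    case (step1 i)
    then show ?case using step[of i] by (simp add: algebra_simps)
  next
    case (step2 i)
    then show ?case using step[of "i - 1"] by (simp add: algebra_simps)
  qed
qed

text \<open>An element outside the free part has a nonzero exponent of \<open>t\<close>, which is a homomorphism; for a
  nontrivial element of the free part, a nonzero Magnus coefficient of lowest positive degree is
  linear on powers.\<close>

lemma cyclic_subgroup_separable_gersten_group: "cyclic_subgroup_separable gersten_group"
proof (rule GG.cyclic_subgroup_separableI)
  fix g assume g: "g \<in> carrier gersten_group" "g \<noteq> \<one>\<^bsub>gersten_group\<^esub>"
  obtain e where e: "e \<in> hom gersten_group integer_group" "e (gelt gen_t) = 1"
    "\<And>x. x \<noteq> gen_t \<Longrightarrow> e (gelt x) = 0"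
    using t_exponent by blast
  interpret e: group_hom gersten_group integer_group e
    using e(1) by (simp add: group_hom_def group_hom_axioms_def GG.is_group)
  obtain u j where u: "u \<in> free_part" "g = u \<otimes>\<^bsub>gersten_group\<^esub> gelt gen_t [^]\<^bsub>gersten_group\<^esub> (j::int)"
    using free_by_cyclic_decomposition[OF g(1)] .
  have "e u = 0"
    using u(1) by (induction rule: free_part_induct) (simp_all add: e)
  then have eg: "e g = j" using u by (simp add: e.hom_int_pow e)
  show "\<exists>c. profinitely_continuous gersten_group c \<and> c g \<noteq> 0 \<and>
      (\<forall>k::int. c (g [^]\<^bsub>gersten_group\<^esub> k) = k * c g)"
  proof (cases "j = 0")
    case False
    then show ?thesis
      using GG.profinitely_continuous_hom[OF e(1)] eg g(1)
      by (intro exI[of _ e]) (simp add: e.hom_int_pow)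
  next
    case True
    then have gF: "g \<in> free_part" using u by simp
    let ?P = "\<lambda>s. s \<noteq> [] \<and> magnus g one_series s \<noteq> 0"
    define s where "s = (ARG_MIN length s. ?P s)"
    obtain s0 where "?P s0" using magnus_faithful_free_part[OF gF g(2)] by blast
    then have s: "?P s" unfolding s_def by (rule arg_min_natI)
    have low: "magnus g one_series s' = 0" if "s' \<noteq> []" "length s' < length s" for s'
      using arg_min_nat_le[of ?P s' length] that by (force simp: s_def)
    have "magnus (g [^]\<^bsub>gersten_group\<^esub> k) one_series s = k * magnus g one_series s" for k :: int
      using leading_coefficient_pow[OF gF low, of "length s" s k] s by blast
    then show ?thesis
      using profinitely_continuous_coefficient[of one_series s] s
      by (intro exI[of _ "\<lambda>g. magnus g one_series s"]) simp
  qed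
qed


section \<open>The Gersten group does not have property (VRC)\<close>

text \<open>A virtual retraction onto \<open>\<langle>a\<rangle>\<close>, followed by the coefficient of the monomial \<open>a\<close>, which recovers
  \<open>k\<close> from \<open>a\<^sup>k\<close>, would be a homomorphism to \<open>\<int>\<close> with value \<open>1\<close> at \<open>a\<close>.\<close>

lemma not_has_VRC_gersten_group: "\<not> has_VRC gersten_group"
proof
  let ?a = "gelt gen_a" and ?b = "gelt gen_b" and ?c = "gelt gen_c" and ?t = "gelt gen_t"
  let ?C = "generate gersten_group {?a}"
  assume "has_VRC gersten_group"
  from bspec[OF this[unfolded has_VRC_def Let_def] gelt_closed[of gen_a]]
  obtain H r where H: "finite_index_subgroup H gersten_group" "?C \<subseteq> H"
    and r: "r \<in> epi (gersten_group\<lparr>carrier := H\<rparr>) (gersten_group\<lparr>carrier := ?C\<rparr>)" "\<forall>x\<in>?C. r x = x"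
    by (elim exE conjE bexE)
  define f where "f x = magnus (r x) one_series [gen_a]" for x
  have a_pow: "magnus (?a [^]\<^bsub>gersten_group\<^esub> k) one_series [gen_a] = k" for k :: int
    using magnus_pow(2)[of gen_a "[]" k one_series] by (simp add: one_series_def)
  have "f (x \<otimes>\<^bsub>gersten_group\<^esub> y) = f x + f y" if "x \<in> H" "y \<in> H" for x y
  proof -
    have hom: "r \<in> hom (gersten_group\<lparr>carrier := H\<rparr>) (gersten_group\<lparr>carrier := ?C\<rparr>)"
      using r(1) by (simp add: epi_def)
    then have "r x \<in> ?C" "r y \<in> ?C" using that hom_in_carrier[OF hom] by simp_all
    then obtain i j :: int where "r x = ?a [^]\<^bsub>gersten_group\<^esub> i" "r y = ?a [^]\<^bsub>gersten_group\<^esub> j"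
      by (auto simp: GG.generate_pow)
    moreover have "r (x \<otimes>\<^bsub>gersten_group\<^esub> y) = r x \<otimes>\<^bsub>gersten_group\<^esub> r y"
      using hom_mult[OF hom, of x y] that by simp
    ultimately show ?thesis by (simp add: f_def a_pow flip: GG.int_pow_mult)
  qed
  moreover have aC: "?a \<in> ?C" by (rule generate.incl) simp
  moreover have "?b \<otimes>\<^bsub>gersten_group\<^esub> (?a \<otimes>\<^bsub>gersten_group\<^esub> ?t) \<otimes>\<^bsub>gersten_group\<^esub> inv\<^bsub>gersten_group\<^esub> ?b = ?t"
    using GG.conj_eq_iff[of "?a \<otimes>\<^bsub>gersten_group\<^esub> ?t" ?t ?b] gersten_relations(2)
    by (simp add: GG.m_assoc)
  moreover have "?c \<otimes>\<^bsub>gersten_group\<^esub> (?a \<otimes>\<^bsub>gersten_group\<^esub> ?a \<otimes>\<^bsub>gersten_group\<^esub> ?t)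
      \<otimes>\<^bsub>gersten_group\<^esub> inv\<^bsub>gersten_group\<^esub> ?c = ?t"
    using GG.conj_eq_iff[of "?a \<otimes>\<^bsub>gersten_group\<^esub> ?a \<otimes>\<^bsub>gersten_group\<^esub> ?t" ?t ?c] gersten_relations(3)
    by (simp add: GG.m_assoc)
  ultimately have "f ?a = 0"
    using H gelt_closed gersten_relations(1)[symmetric]
    by (intro GG.virtual_hom_vanishes[where H = H and t = ?t and b = ?b and c = ?c])
      (simp_all only: finite_index_subgroup_def subset_iff)
  moreover have "f ?a = 1" using r(2) aC a_pow[of 1] by (simp add: f_def)
  ultimately show False by simp
qed

theorem theorem1p12:
  shows "cyclic_subgroup_separable gersten_group \<and> tubular_group gersten_group \<and>
    \<not> has_VRC gersten_group"
  using cyclic_subgroup_separable_gersten_group tubular_gersten_group not_has_VRC_gersten_group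
  by blast

end
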